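(* Let $f,g:\mathbb{R}^{d_x}\times\mathbb{R}^{d_y}\to\mathbb{R}$ and let $\mu,\bar\sigma,l_f,L_f,L_g,\rho_f,\rho_g>0$ be constants such that: (1) for every $0\le\sigma\le\bar\sigma$ and every $x$, the function $y\mapsto \sigma f(x,y)+g(x,y)$ is $\mu$-PŁ; (2) $f$ is $l_f$-Lipschitz with $L_f$-Lipschitz gradient; (3) $g$ has $L_g$-Lipschitz gradient; (4) $f$ has $\rho_f$-Lipschitz Hessian; (5) $g$ has $\rho_g$-Lipschitz Hessian. Suppose also that $\varphi^*:=\inf_x\varphi(x)>-\infty$. Fix the initial points $x_0,y_0,z_0$ and the parameters $a_0,b_0,c_0>0$, $\alpha>1$, $L_{0,1},L_{0,2}>0$ of the bilevel algorithm described in the context, and run it with error tolerance $\epsilon>0$, $\sigma=\epsilon$, $\epsilon_y=\epsilon_z=\epsilon^2$ and $T=1/\epsilon^2$ outer iterations, where $\epsilon$ is sufficiently small (in particular $\epsilon\le\min\{\rho_g/\rho_f,\bar\sigma\}$). Then, for either choice of inner solver, the generated sequence $\{x_t\}$ satisfies $$\min_{0\le t\le T-1}\|\nabla\varphi(x_t)\|\le \mathcal{O}(\epsilon).$$ Furthermore, the total number of first-order oracle calls is $\mathcal{O}(1/\epsilon^6)$ when the inner solver is AdaG-N (the algorithm AF$^2$BA), and $\tilde{\mathcal{O}}(1/\epsilon^2)$ when the inner solver is AC-GM (the algorithm A$^2$F$^2$BA).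
   Context: Asymptotic notation: $\mathcal{O}(\cdot)$ is as $\epsilon\to0^+$, with implied constants depending only on the problem constants, $f,g$, the initial points and the initial parameters, not on $\epsilon$; $\tilde{\mathcal{O}}$ additionally hides factors that are logarithmic in $1/\epsilon$. A first-order oracle call is an evaluation of $f$ or $g$ together with its gradient at one point. PŁ condition: $h:\mathbb{R}^d\to\mathbb{R}$ with minimum value $h^*=\min h$ is $\mu$-PŁ ($\mu>0$) if $2\mu(h(x)-h^* )\le\|\nabla h(x)\|^2$ for all $x$. (All minima written as $\min$ are understood to be attained.) Hyper-objective: $Y^*(x)=\arg\min_{y}g(x,y)$ and $\varphi(x)=\min_{y\in Y^*(x)}f(x,y)$. Under assumptions (1)--(5) $\varphi$ is differentiable (known result). Bilevel algorithm. Inputs: $x_0,y_0,z_0$; $a_0,b_0,c_0>0$; $\alpha>1$; $L_{0,1},L_{0,2}>0$; $\epsilon>0$. Set $T=1/\epsilon^2$ (understood as an integer), $\epsilon_z=\epsilon_y=\epsilon^2$, $\sigma=\epsilon$. For $t=0,\dots,T-1$: (i) let $z_t^0=z_{t-1}^{K_{t-1}}$ if $t>0$ and $z_0^0=z_0$; compute $(z_t^{K_t},K_t)$ by $\text{AdaG-N}(g(x_t,\cdot),z_t^0,b_0,\epsilon_z)$ [variant AF$^2$BA] or by $\text{AC-GM}(g(x_t,\cdot),z_t^0,\alpha,L_{0,1},\epsilon_z)$ [variant A$^2$F$^2$BA]; (ii) let $y_t^0=y_{t-1}^{N_{t-1}}$ if $t>0$ and $y_0^0=y_0$; compute $(y_t^{N_t},N_t)$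 by $\text{AdaG-N}(\sigma f(x_t,\cdot)+g(x_t,\cdot),y_t^0,c_0,\epsilon_y)$ [AF$^2$BA] or by $\text{AC-GM}(\sigma f(x_t,\cdot)+g(x_t,\cdot),y_t^0,\alpha,L_{0,2},\epsilon_y)$ [A$^2$F$^2$BA]; (iii) $\widehat\nabla_t=\nabla_xf(x_t,y_t^{N_t})+\big(\nabla_xg(x_t,y_t^{N_t})-\nabla_xg(x_t,z_t^{K_t})\big)/\sigma$, $a_{t+1}=\sqrt{a_t^2+\|\widehat\nabla_t\|^2}$, $x_{t+1}=x_t-\widehat\nabla_t/a_{t+1}$. $\text{AdaG-N}(h,x^0,\alpha_0,\epsilon_h)$: start with $k=0$; while $\|\nabla h(x^k)\|>\epsilon_h$, set $\alpha_{k+1}=\sqrt{\alpha_k^2+\|\nabla h(x^k)\|^2}$, $x^{k+1}=x^k-\nabla h(x^k)/\alpha_{k+1}$, $k\leftarrow k+1$. Return $(x^k,k)$. $\text{AC-GM}(h,x^0,\alpha,L_0,\epsilon_h)$: start with $k=0$; while $\|\nabla h(x^k)\|>\epsilon_h$, set $\gamma_{k+1}=\max\{L_0,\dots,L_k\}$, $x^{k+1}=x^k-\frac{1}{\alpha\gamma_{k+1}}\nabla h(x^k)$, $L_{k+1}=\frac{2(h(x^{k+1})-h(x^k)-\langle\nabla h(x^k),x^{k+1}-x^k\rangle)}{\|x^{k+1}-x^k\|^2}$, $k\leftarrow k+1$. Return $(x^k,k)$. *)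

theory Defs
  imports
    "HOL-Analysis.Analysis"
    "HOL-Library.Landau_Symbols"
    "HOL-Library.While_Combinator"
begin

definition grad :: "('a::real_inner \<Rightarrow> real) \<Rightarrow> 'a \<Rightarrow> 'a" where
  "grad h x = (THE D. GDERIV h x :> D)"

(* The Hessian is the derivative of the gradient as a bounded linear map, so that
   distances between Hessians are measured in the operator norm. *)
definition hessian :: "('a::real_inner \<Rightarrow> real) \<Rightarrow> 'a \<Rightarrow> 'a \<Rightarrow>\<^sub>L 'a" where
  "hessian h x = Blinfun (frechet_derivative (grad h) (at x))"

definition lipschitz_gradient :: "real \<Rightarrow> ('a::real_inner \<Rightarrow> real) \<Rightarrow> bool" where
  "lipschitz_gradient L h \<longleftrightarrow>
     (\<forall>x. h differentiable (at x)) \<and> L-lipschitz_on UNIV (grad h)"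

definition lipschitz_hessian :: "real \<Rightarrow> ('a::real_inner \<Rightarrow> real) \<Rightarrow> bool" where
  "lipschitz_hessian \<rho> h \<longleftrightarrow>
     (\<forall>x. h differentiable (at x)) \<and> (\<forall>x. grad h differentiable (at x)) \<and>
     \<rho>-lipschitz_on UNIV (hessian h)"

(* The Polyak-Lojasiewicz condition. The second conjunct says that the minimum is attained,
   so that the infimum in the third is the minimum value. *)
definition PL :: "real \<Rightarrow> ('a::real_inner \<Rightarrow> real) \<Rightarrow> bool" where
  "PL \<mu> h \<longleftrightarrow>
     (\<forall>x. h differentiable (at x)) \<and>
     (\<exists>x. \<forall>y. h x \<le> h y) \<and>
     (\<forall>x. 2 * \<mu> * (h x - (INF y. h y)) \<le> (norm (grad h x))\<^sup>2)"

definition lower_argmin :: "('a \<times> 'b \<Rightarrow> real) \<Rightarrow> 'a \<Rightarrow> 'b set" where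
  "lower_argmin g x = {y. \<forall>y'. g (x, y) \<le> g (x, y')}"

(* The infimum is the minimum of the informal definition whenever the latter is attained. *)
definition hyper_objective ::
    "('a \<times> 'b \<Rightarrow> real) \<Rightarrow> ('a \<times> 'b \<Rightarrow> real) \<Rightarrow> 'a \<Rightarrow> real" where
  "hyper_objective f g x = (INF y\<in>lower_argmin g x. f (x, y))"


(* The inner solvers return the final point and the number of iterations, or None if the
   loop does not terminate. *)

definition AdaG_N ::
    "('v::real_inner \<Rightarrow> real) \<Rightarrow> 'v \<Rightarrow> real \<Rightarrow> real \<Rightarrow> ('v \<times> nat) option" where
  "AdaG_N h v\<^sub>0 \<alpha>\<^sub>0 \<epsilon> =
     map_option (\<lambda>(v, \<alpha>, k). (v, k))
       (while_option
          (\<lambda>(v, \<alpha>, k). norm (grad h v) > \<epsilon>)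
          (\<lambda>(v, \<alpha>, k).
             let \<alpha>' = sqrt (\<alpha>\<^sup>2 + (norm (grad h v))\<^sup>2)
             in (v - (1 / \<alpha>') *\<^sub>R grad h v, \<alpha>', Suc k))
          (v\<^sub>0, \<alpha>\<^sub>0, 0))"

(* The list in the state holds the local estimates L_k, ..., L_0. *)
definition AC_GM ::
    "('v::real_inner \<Rightarrow> real) \<Rightarrow> 'v \<Rightarrow> real \<Rightarrow> real \<Rightarrow> real \<Rightarrow> ('v \<times> nat) option" where
  "AC_GM h v\<^sub>0 \<alpha> L\<^sub>0 \<epsilon> =
     map_option (\<lambda>(v, Ls, k). (v, k))
       (while_option
          (\<lambda>(v, Ls, k). norm (grad h v) > \<epsilon>)
          (\<lambda>(v, Ls, k).
             let \<gamma> = Max (set Ls);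
                 v' = v - (1 / (\<alpha> * \<gamma>)) *\<^sub>R grad h v;
                 L' = 2 * (h v' - h v - grad h v \<bullet> (v' - v)) / (norm (v' - v))\<^sup>2
             in (v', L' # Ls, Suc k))
          (v\<^sub>0, [L\<^sub>0], 0))"

(* The state at the start of outer iteration t: y_pt and z_pt are the warm starts
   y_t^0 and z_t^0, and calls counts the oracle calls made in iterations 0, ..., t - 1. *)
record ('a, 'b) bilevel_state =
  x_pt :: 'a
  y_pt :: 'b
  z_pt :: 'b
  a_par :: real
  calls :: nat

(* The inner solvers, with everything but the objective and the starting point fixed, are
   parameters. Oracle calls: a solver run of k iterations evaluates its objective with its
   gradient at k + 1 points, each needing one call for g, and two calls (one for f, one for g)
   for \<sigma> f + g; the hypergradient estimate is charged three further calls, although the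
   evaluations made by the solvers at the same points could be reused. *)
definition bilevel_step ::
    "(('b \<Rightarrow> real) \<Rightarrow> 'b \<Rightarrow> ('b \<times> nat) option) \<Rightarrow>
     (('b \<Rightarrow> real) \<Rightarrow> 'b \<Rightarrow> ('b \<times> nat) option) \<Rightarrow>
     ('a::real_inner \<times> 'b::real_inner \<Rightarrow> real) \<Rightarrow> ('a \<times> 'b \<Rightarrow> real) \<Rightarrow> real \<Rightarrow>
     ('a, 'b) bilevel_state \<Rightarrow> ('a, 'b) bilevel_state option" where
  "bilevel_step solve_z solve_y f g \<sigma> s =
     (let x = x_pt s in
      Option.bind (solve_z (\<lambda>y. g (x, y)) (z_pt s)) (\<lambda>(z, K).
      Option.bind (solve_y (\<lambda>y. \<sigma> * f (x, y) + g (x, y)) (y_pt s)) (\<lambda>(y, N).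
      let d = grad (\<lambda>u. f (u, y)) x +
              (1 / \<sigma>) *\<^sub>R (grad (\<lambda>u. g (u, y)) x - grad (\<lambda>u. g (u, z)) x);
          a' = sqrt ((a_par s)\<^sup>2 + (norm d)\<^sup>2)
      in Some \<lparr>x_pt = x - (1 / a') *\<^sub>R d, y_pt = y, z_pt = z, a_par = a',
               calls = calls s + (K + 1) + 2 * (N + 1) + 3\<rparr>)))"

(* None means that some inner loop among the first t outer iterations does not terminate. *)
primrec bilevel ::
    "(('b \<Rightarrow> real) \<Rightarrow> 'b \<Rightarrow> ('b \<times> nat) option) \<Rightarrow>
     (('b \<Rightarrow> real) \<Rightarrow> 'b \<Rightarrow> ('b \<times> nat) option) \<Rightarrow>
     ('a::real_inner \<times> 'b::real_inner \<Rightarrow> real) \<Rightarrow> ('a \<times> 'b \<Rightarrow> real) \<Rightarrow> real \<Rightarrow>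
     'a \<Rightarrow> 'b \<Rightarrow> 'b \<Rightarrow> real \<Rightarrow> nat \<Rightarrow> ('a, 'b) bilevel_state option" where
  "bilevel solve_z solve_y f g \<sigma> x\<^sub>0 y\<^sub>0 z\<^sub>0 a\<^sub>0 0 =
     Some \<lparr>x_pt = x\<^sub>0, y_pt = y\<^sub>0, z_pt = z\<^sub>0, a_par = a\<^sub>0, calls = 0\<rparr>"
| "bilevel solve_z solve_y f g \<sigma> x\<^sub>0 y\<^sub>0 z\<^sub>0 a\<^sub>0 (Suc t) =
     Option.bind (bilevel solve_z solve_y f g \<sigma> x\<^sub>0 y\<^sub>0 z\<^sub>0 a\<^sub>0 t)
       (bilevel_step solve_z solve_y f g \<sigma>)"

definition AF2BA ::
    "('a::real_inner \<times> 'b::real_inner \<Rightarrow> real) \<Rightarrow> ('a \<times> 'b \<Rightarrow> real) \<Rightarrow>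
     'a \<Rightarrow> 'b \<Rightarrow> 'b \<Rightarrow> real \<Rightarrow> real \<Rightarrow> real \<Rightarrow> real \<Rightarrow> nat \<Rightarrow> ('a, 'b) bilevel_state option" where
  "AF2BA f g x\<^sub>0 y\<^sub>0 z\<^sub>0 a\<^sub>0 b\<^sub>0 c\<^sub>0 \<epsilon> =
     bilevel (\<lambda>h v. AdaG_N h v b\<^sub>0 (\<epsilon>\<^sup>2)) (\<lambda>h v. AdaG_N h v c\<^sub>0 (\<epsilon>\<^sup>2)) f g \<epsilon> x\<^sub>0 y\<^sub>0 z\<^sub>0 a\<^sub>0"

definition A2F2BA ::
    "('a::real_inner \<times> 'b::real_inner \<Rightarrow> real) \<Rightarrow> ('a \<times> 'b \<Rightarrow> real) \<Rightarrow>
     'a \<Rightarrow> 'b \<Rightarrow> 'b \<Rightarrow> real \<Rightarrow> real \<Rightarrow> real \<Rightarrow> real \<Rightarrow> real \<Rightarrow> nat \<Rightarrow> ('a, 'b) bilevel_state option" where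
  "A2F2BA f g x\<^sub>0 y\<^sub>0 z\<^sub>0 a\<^sub>0 \<alpha> L\<^sub>1 L\<^sub>2 \<epsilon> =
     bilevel (\<lambda>h v. AC_GM h v \<alpha> L\<^sub>1 (\<epsilon>\<^sup>2)) (\<lambda>h v. AC_GM h v \<alpha> L\<^sub>2 (\<epsilon>\<^sup>2)) f g \<epsilon> x\<^sub>0 y\<^sub>0 z\<^sub>0 a\<^sub>0"

(* The number of outer iterations is 1 / \<epsilon>^2, rounded up when this is not an integer. *)
definition outer_iters :: "real \<Rightarrow> nat" where
  "outer_iters \<epsilon> = nat \<lceil>1 / \<epsilon>\<^sup>2\<rceil>"

(* A run maps the tolerance and an outer iteration index to the state; the two functions
   below are meaningful for tolerances at which the run terminates. *)

definition best_grad_norm ::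
    "('a::real_inner \<Rightarrow> real) \<Rightarrow> (real \<Rightarrow> nat \<Rightarrow> ('a, 'b) bilevel_state option) \<Rightarrow> real \<Rightarrow> real" where
  "best_grad_norm \<phi> run \<epsilon> =
     (MIN t\<in>{..<outer_iters \<epsilon>}. norm (grad \<phi> (x_pt (the (run \<epsilon> t)))))"

definition oracle_calls ::
    "(real \<Rightarrow> nat \<Rightarrow> ('a, 'b) bilevel_state option) \<Rightarrow> real \<Rightarrow> nat" where
  "oracle_calls run \<epsilon> = calls (the (run \<epsilon> (outer_iters \<epsilon>)))"

end

(* Let h_s = s f + g, V_s(x) = min_y h_s(x, y) and W_s = grad V_s. By the PL error bound the
   minimisers of h_s(x, _) move by O(|dx| + |ds|), so V_s is differentiable (Danskin), and W_s(x) is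
   the x-component of grad h_s at any point that is a minimiser up to a small y-gradient. As the
   Hessian of g is Lipschitz, the point extrapolated linearly from nearby minimisers is a minimiser
   up to second order. This bounds second differences of W in (s, x), with no second derivative or
   pseudo-inverse of V:
     |W_s(x') - W_s(x) - W_0(x') + W_0(x)| = O(s |x' - x|),   |W_2s - 2 W_s + W_0| = O(s^2).
   The first bound makes the penalty (V_s - V_0) / s smooth uniformly in s. By the second one its
   gradients at s / 2^n converge geometrically, and hence phi is smooth with gradient within O(s) of
   (W_s - W_0) / s.

   The outer loop is AdaGrad-Norm on phi with gradient errors of O(eps), whose squares sum to O(1)
   over 1 / eps^2 steps. As a step has length at most 1, every warm start has a bounded y-gradient,
   which bounds each inner run by O(1 / eps^4) iterations for AdaG-N and O(log (1 / eps)) for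
   AC-GM. *)

theory Submission
  imports Defs
begin

section \<open>Gradients, smoothness and the PL error bound\<close>

text \<open>A PL function may have a continuum of minimisers and a singular Hessian in
  \<open>y\<close>, which rules out the implicit function theorem. What remains is the error bound:
  a small \<open>y\<close>-gradient puts some minimiser close by. It is used both to carry a
  minimiser over to nearby parameters and to compare the gradient at an approximate minimiser with
  W_s. Every minimiser yields the derivative of the same function V_s, so minimisers may be chosen
  afresh at each use and no selection has to be regular.

  The estimate of the hypergradient divides by s, which magnifies inner errors delta to delta / s;
  hence s = eps calls for the inner tolerance eps^2. For AdaG-N this gives 1 / eps^2 outer steps
  times 1 / (eps^2)^2 inner ones.

  The inner bounds see a starting point only through its gradient, which PL converts into a bound on
  the gap. So neither the iterates nor the sets of minimisers need to be bounded.\<close>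

lemma GDERIV_unique:
  assumes "GDERIV h x :> D" "GDERIV h x :> D'"
  shows "D = D'"
proof -
  have "(\<lambda>v. v \<bullet> D) = (\<lambda>v. v \<bullet> D')"
    using assms unfolding gderiv_def by (rule has_derivative_unique)
  then show ?thesis by (metis vector_eq_ldot)
qed

lemma grad_eq: "GDERIV h x :> D \<Longrightarrow> grad h x = D"
  unfolding grad_def by (rule the_equality) (auto dest: GDERIV_unique)

lemma differentiable_imp_GDERIV_grad:
  fixes h :: "'a::euclidean_space \<Rightarrow> real"
  assumes "h differentiable (at x)"
  shows "GDERIV h x :> grad h x"
proof -
  obtain h' where h': "(h has_derivative h') (at x)"
    using assms unfolding differentiable_def by blast
  then interpret bounded_linear h' by (rule has_derivative_bounded_linear)
  have "h' v = v \<bullet> (\<Sum>b\<in>Basis. h' b *\<^sub>R b)" for v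
  proof -
    have "h' v = h' (\<Sum>b\<in>Basis. (v \<bullet> b) *\<^sub>R b)" by (simp add: euclidean_representation)
    also have "\<dots> = v \<bullet> (\<Sum>b\<in>Basis. h' b *\<^sub>R b)"
      by (simp add: sum scale inner_sum_right mult.commute)
    finally show ?thesis .
  qed
  then have "h' = (\<lambda>v. v \<bullet> (\<Sum>b\<in>Basis. h' b *\<^sub>R b))" by blast
  then have "GDERIV h x :> (\<Sum>b\<in>Basis. h' b *\<^sub>R b)"
    using h' unfolding gderiv_def by simp
  then show ?thesis using grad_eq by force
qed

text \<open>The mean value inequality is applied to \<open>h z - D x \<bullet> z\<close> on the
  segment. It gives \<open>L\<close> where integration would give \<open>L / 2\<close>; this factor
  returns in the step \<open>1 / (2 * L)\<close>, in the gap bound \<open>4 * L\<close> and in the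
  bound \<open>2 * L\<close> on the estimates of AC-GM.\<close>

lemma GDERIV_quadratic_bound:
  fixes h :: "'a::euclidean_space \<Rightarrow> real"
  assumes "\<And>x. GDERIV h x :> D x" and lip: "\<And>x y. norm (D x - D y) \<le> L * norm (x - y)"
  shows "\<bar>h y - h x - D x \<bullet> (y - x)\<bar> \<le> L * (norm (y - x))\<^sup>2"
proof -
  have L: "0 \<le> L * norm (y - x)" 
    using lip[of y x] norm_ge_zero[of "D y - D x"] by linarith
  have der: "((\<lambda>z. h z - D x \<bullet> z) has_derivative (\<lambda>v. (D z - D x) \<bullet> v)) (at z within S)" for z S
  proof -
    have "(h has_derivative (\<lambda>v. v \<bullet> D z)) (at z within S)"
      using assms(1)[of z] unfolding gderiv_def by (rule has_derivative_at_withinI)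
    then have "((\<lambda>z. h z - D x \<bullet> z) has_derivative (\<lambda>v. v \<bullet> D z - D x \<bullet> v)) (at z within S)"
      by (intro derivative_intros) auto
    then show ?thesis
      by (rule has_derivative_eq_rhs) (simp add: fun_eq_iff inner_diff_right inner_commute)
  qed
  have "norm ((h y - D x \<bullet> y) - (h x - D x \<bullet> x)) \<le> (L * norm (y - x)) * norm (y - x)"
  proof (rule differentiable_bound[of "closed_segment x y" "\<lambda>z. h z - D x \<bullet> z" "\<lambda>z v. (D z - D x) \<bullet> v"])
    fix z assume z: "z \<in> closed_segment x y"
    have "norm (D z - D x) \<le> L * norm (z - x)" by (rule lip)
    also have "\<dots> \<le> L * norm (y - x)"
    proof (cases "x = y")
      case False
      then have "L \<ge> 0" using L by (simp add: zero_le_mult_iff)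
      then show ?thesis using segment_bound1[OF z] by (simp add: mult_left_mono)
    qed (use z in auto)
    finally have "norm ((D z - D x) \<bullet> v) \<le> L * norm (y - x) * norm v" for v
      using Cauchy_Schwarz_ineq2[of "D z - D x" v] mult_right_mono[OF _ norm_ge_zero[of v]] by fastforce
    then show "onorm (\<lambda>v. (D z - D x) \<bullet> v) \<le> L * norm (y - x)"
      by (rule onorm_le)
  qed (use der in auto)
  then show ?thesis
    by (simp add: inner_diff_right power2_eq_square mult.assoc algebra_simps)
qed

lemma lipschitz_gradientD:
  fixes h :: "'a::euclidean_space \<Rightarrow> real"
  assumes "lipschitz_gradient L h"
  shows "GDERIV h x :> grad h x" and "norm (grad h x - grad h y) \<le> L * norm (x - y)"
  using assms differentiable_imp_GDERIV_grad[of h x] lipschitz_onD[of L UNIV "grad h" x y]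
  unfolding lipschitz_gradient_def dist_norm by simp_all

lemma lipschitz_gradientI:
  fixes h :: "'a::euclidean_space \<Rightarrow> real"
  assumes "\<And>x. GDERIV h x :> D x" and "\<And>x y. norm (D x - D y) \<le> L * norm (x - y)" and "0 \<le> L"
  shows "lipschitz_gradient L h"
proof -
  have "grad h = D" using grad_eq[OF assms(1)] by blast
  moreover have "h differentiable (at x)" for x
    using assms(1)[of x] unfolding gderiv_def differentiable_def by blast
  ultimately show ?thesis
    unfolding lipschitz_gradient_def using assms(2,3) by (auto intro!: lipschitz_onI simp: dist_norm)
qed

lemma lipschitz_gradient_quadratic_bound:
  fixes h :: "'a::euclidean_space \<Rightarrow> real"
  assumes "lipschitz_gradient L h"
  shows "\<bar>h y - h x - grad h x \<bullet> (y - x)\<bar> \<le> L * (norm (y - x))\<^sup>2"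
  using GDERIV_quadratic_bound[of h "grad h" L] lipschitz_gradientD[OF assms] by blast

text \<open>With \<open>n\<close> the gradient norm, \<open>1 / (2 * L)\<close> is the step length
  \<open>t\<close> that minimises the upper bound
  \<open>- t * n\<^sup>2 + L * t\<^sup>2 * n\<^sup>2\<close> on the change of
  \<open>h\<close>.\<close>

lemma gradient_step_decrease:
  fixes h :: "'a::euclidean_space \<Rightarrow> real"
  assumes "lipschitz_gradient L h" "L > 0"
  shows "h (y - (1 / (2 * L)) *\<^sub>R grad h y) \<le> h y - (norm (grad h y))\<^sup>2 / (4 * L)"
proof -
  define d where "d = - (1 / (2 * L)) *\<^sub>R grad h y"
  define q where "q = (norm (grad h y))\<^sup>2 / (4 * L)"
  have "h (y + d) - h y - grad h y \<bullet> d \<le> L * (norm d)\<^sup>2"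
    using lipschitz_gradient_quadratic_bound[OF assms(1), of "y + d" y] by simp
  moreover have "grad h y \<bullet> d = - 2 * q"
    by (simp add: d_def q_def power2_norm_eq_inner)
  moreover have "L * (norm d)\<^sup>2 = q"
    using assms(2) unfolding d_def q_def
    by (simp add: power_mult_distrib power_divide field_simps power2_eq_square)
  ultimately have "h (y + d) \<le> h y - q" by linarith
  then show ?thesis by (simp add: d_def q_def)
qed

text \<open>A gradient step cannot go below \<open>m\<close>, so its guaranteed decrease is at most
  the gap.\<close>

lemma gradient_norm_le_gap:
  fixes h :: "'a::euclidean_space \<Rightarrow> real"
  assumes "lipschitz_gradient L h" "L > 0" "\<And>y. m \<le> h y"
  shows "(norm (grad h y))\<^sup>2 \<le> 4 * L * (h y - m)"
proof -
  have "m \<le> h y - (norm (grad h y))\<^sup>2 / (4 * L)"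
    using gradient_step_decrease[OF assms(1,2), of y] assms(3) by (rule order_trans[rotated])
  then show ?thesis using assms(2) by (simp add: field_simps)
qed

lemma PL_minimum:
  assumes "PL \<mu> h"
  obtains m where "\<And>y. m \<le> h y" "\<And>y. 2 * \<mu> * (h y - m) \<le> (norm (grad h y))\<^sup>2"
    "\<And>y. (\<forall>y'. h y \<le> h y') \<longleftrightarrow> h y = m"
proof -
  obtain x where x: "\<forall>y. h x \<le> h y" using assms unfolding PL_def by blast
  have "(INF y. h y) = h x" using x by (intro cInf_eq_minimum) auto
  then show ?thesis using that[of "h x"] x assms unfolding PL_def by (metis order_antisym)
qed

text \<open>The minimiser comes from minimising \<open>sqrt (h y - m) + c * norm (y - y\<^sub>0)\<close>: off the
  minimum set of \<open>h\<close>, a gradient step still decreases this function.\<close>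

lemma PL_error_bound:
  fixes h :: "'a::euclidean_space \<Rightarrow> real"
  assumes pl: "PL \<mu> h" and "\<mu> > 0" and lg: "lipschitz_gradient L h" and "L > 0"
  obtains y where "\<forall>y'. h y \<le> h y'" and "norm (y - y\<^sub>0) \<le> 4 / \<mu> * norm (grad h y\<^sub>0)"
proof -
  obtain m where m: "\<And>y. m \<le> h y" "\<And>y. 2 * \<mu> * (h y - m) \<le> (norm (grad h y))\<^sup>2"
    and iff: "\<And>y. (\<forall>y'. h y \<le> h y') \<longleftrightarrow> h y = m"
    using PL_minimum[OF pl] by metis
  \<comment> \<open>A gradient step of length \<open>n / (2 * L)\<close> lowers
    \<open>r = sqrt (h y - m)\<close> by at least \<open>n\<^sup>2 / (8 * L * r)\<close>, a ratio of
    at least \<open>sqrt (2 * \<mu>) / 4\<close>. Half of this ratio leaves room for a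
    contradiction. The final constant \<open>4 / \<mu>\<close> is
    \<open>1 / (c * sqrt (2 * \<mu>))\<close>.\<close>
  define c where "c = sqrt (2 * \<mu>) / 8"
  define \<Phi> where "\<Phi> y = sqrt (h y - m) + c * norm (y - y\<^sub>0)" for y
  \<comment> \<open>Outside this ball the distance term alone exceeds
    \<open>\<Phi> y\<^sub>0\<close>, so the minimum over the compact ball is global.\<close>
  define R where "R = sqrt (h y\<^sub>0 - m) / c"
  have c: "c > 0" using \<open>\<mu> > 0\<close> by (simp add: c_def)
  have R: "R \<ge> 0" using c m(1) by (simp add: R_def)
  have "h differentiable (at x within cball y\<^sub>0 R)" for x
    using lg by (simp add: lipschitz_gradient_def differentiable_at_withinI)
  then have "continuous_on (cball y\<^sub>0 R) h"
    using differentiable_imp_continuous_on[of h] unfolding differentiable_on_def by blast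
  then have "continuous_on (cball y\<^sub>0 R) \<Phi>"
    unfolding \<Phi>_def by (intro continuous_intros)
  then obtain y where y: "y \<in> cball y\<^sub>0 R" "\<And>y'. y' \<in> cball y\<^sub>0 R \<Longrightarrow> \<Phi> y \<le> \<Phi> y'"
    using continuous_attains_inf[of "cball y\<^sub>0 R" \<Phi>] R by (metis compact_cball centre_in_cball empty_iff)
  have y0: "\<Phi> y \<le> \<Phi> y\<^sub>0" using y(2) R by simp
  have ymin: "\<Phi> y \<le> \<Phi> y'" for y'
  proof (cases "y' \<in> cball y\<^sub>0 R")
    case False
    then have "sqrt (h y\<^sub>0 - m) \<le> c * norm (y' - y\<^sub>0)"
      using c by (simp add: R_def dist_norm norm_minus_commute field_simps)
    moreover have "0 \<le> sqrt (h y' - m)" using m(1) by simp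
    ultimately show ?thesis using y0 unfolding \<Phi>_def by (simp only: norm_zero diff_self)
  qed (use y in auto)
  have grad_lb: "sqrt (2 * \<mu>) * sqrt (h y - m) \<le> norm (grad h y)" for y
  proof -
    have "sqrt (2 * \<mu> * (h y - m)) \<le> sqrt ((norm (grad h y))\<^sup>2)"
      by (rule real_sqrt_le_mono[OF m(2)])
    then show ?thesis by (simp add: real_sqrt_mult)
  qed
  have "h y = m"
  proof (rule ccontr)
    assume "h y \<noteq> m"
    then have pos: "h y - m > 0" using m(1)[of y] by simp
    define n where "n = norm (grad h y)"
    define y' where "y' = y - (1 / (2 * L)) *\<^sub>R grad h y"
    define r where "r = sqrt (h y - m)"
    define r' where "r' = sqrt (h y' - m)"
    have r: "r > 0" "r' \<ge> 0" "r\<^sup>2 = h y - m" "r'\<^sup>2 = h y' - m"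
      using pos m(1) by (auto simp: r_def r'_def)
    have nr: "sqrt (2 * \<mu>) * r \<le> n" using grad_lb[of y] by (simp add: r_def n_def)
    moreover have "0 < sqrt (2 * \<mu>) * r" using r \<open>\<mu> > 0\<close> by simp
    ultimately have n: "n > 0" by linarith
    have dec: "r'\<^sup>2 \<le> r\<^sup>2 - n\<^sup>2 / (4 * L)"
      using gradient_step_decrease[OF lg \<open>L > 0\<close>, of y] r by (simp add: y'_def n_def)
    have dist: "norm (y' - y) = n / (2 * L)" using \<open>L > 0\<close> by (simp add: y'_def n_def)
    have "norm (y' - y\<^sub>0) \<le> norm (y - y\<^sub>0) + n / (2 * L)"
      using norm_triangle_ineq[of "y' - y" "y - y\<^sub>0"] dist by simp
    then have "c * norm (y' - y\<^sub>0) \<le> c * (norm (y - y\<^sub>0) + n / (2 * L))"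
      using c by (intro mult_left_mono) auto
    then have "r \<le> r' + c * (n / (2 * L))"
      using ymin[of y'] by (simp add: \<Phi>_def distrib_left r_def r'_def)
    then have 1: "r - r' \<le> c * n / (2 * L)" by simp
    have "n\<^sup>2 / (4 * L) \<le> (r - r') * (r + r')"
      using dec by (simp add: power2_eq_square algebra_simps)
    also have "\<dots> \<le> (c * n / (2 * L)) * (r + r')" using 1 r by (intro mult_right_mono) auto
    also have "\<dots> \<le> (c * n / (2 * L)) * (2 * r)"
    proof (intro mult_left_mono)
      have "r'\<^sup>2 \<le> r\<^sup>2" by (rule order_trans[OF dec]) (use \<open>L > 0\<close> in simp)
      then show "r + r' \<le> 2 * r" using r power2_le_imp_le[of r' r] by simp
    qed (use c n \<open>L > 0\<close> in auto)
    also have "\<dots> = (n / (4 * L)) * ((sqrt (2 * \<mu>) * r) / 2)" by (simp add: c_def field_simps)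
    also have "\<dots> \<le> (n / (4 * L)) * (n / 2)"
      using nr n \<open>L > 0\<close> by (intro mult_left_mono) auto
    finally show False using n \<open>L > 0\<close> by (simp add: field_simps power2_eq_square)
  qed
  moreover have "norm (y - y\<^sub>0) \<le> 4 / \<mu> * norm (grad h y\<^sub>0)"
  proof -
    have "8 * c * (c * norm (y - y\<^sub>0)) \<le> sqrt (2 * \<mu>) * sqrt (h y\<^sub>0 - m)"
      using y0 c \<open>h y = m\<close> unfolding \<Phi>_def c_def by (simp add: mult_left_mono)
    also have "\<dots> \<le> norm (grad h y\<^sub>0)" by (rule grad_lb)
    also have "8 * c * (c * norm (y - y\<^sub>0)) = \<mu> / 4 * norm (y - y\<^sub>0)"
      using \<open>\<mu> > 0\<close> by (simp add: c_def)
    finally show ?thesis using \<open>\<mu> > 0\<close> by (simp add: field_simps)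
  qed
  ultimately show ?thesis using that iff by blast
qed

section \<open>Second differences under a Lipschitz Hessian, and gradients of Lipschitz
  functions\<close>

lemma hessian_derivative:
  fixes h :: "'a::euclidean_space \<Rightarrow> real"
  assumes "lipschitz_hessian \<rho> h"
  shows "(grad h has_derivative blinfun_apply (hessian h x)) (at x)"
proof -
  have "(grad h has_derivative frechet_derivative (grad h) (at x)) (at x)"
    using assms unfolding lipschitz_hessian_def by (simp add: frechet_derivative_works)
  then show ?thesis
    unfolding hessian_def by (simp add: bounded_linear_Blinfun_apply has_derivative_bounded_linear)
qed

text \<open>The increment \<open>grad h (a + z) - grad h z\<close> has as its derivative in
  \<open>z\<close> a difference of two Hessians, of operator norm at most
  \<open>\<rho> * norm a\<close>. The mean value inequality over the displacement \<open>b\<close>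
  gives the product.\<close>

lemma gradient_second_difference:
  fixes h :: "'a::euclidean_space \<Rightarrow> real"
  assumes lh: "lipschitz_hessian \<rho> h"
  shows "norm (grad h (u + a + b) - grad h (u + a) - grad h (u + b) + grad h u) \<le> \<rho> * norm a * norm b"
proof -
  let ?F = "\<lambda>z. grad h (a + z) - grad h z"
  let ?F' = "\<lambda>z. blinfun_apply (hessian h (a + z) - hessian h z)"
  have der: "(?F has_derivative ?F' z) (at z within S)" for z S
  proof -
    have 1: "(grad h has_derivative blinfun_apply (hessian h (a + z))) (at (a + z) within (+) a ` S)"
      by (rule has_derivative_at_withinI[OF hessian_derivative[OF lh]])
    have "((\<lambda>z. grad h (a + z)) has_derivative (\<lambda>v. blinfun_apply (hessian h (a + z)) v)) (at z within S)"
      by (rule has_derivative_in_compose[OF _ 1]) (auto intro!: derivative_eq_intros)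
    then have "(?F has_derivative (\<lambda>v. hessian h (a + z) v - hessian h z v)) (at z within S)"
      using has_derivative_at_withinI[OF hessian_derivative[OF lh]] by (rule has_derivative_diff)
    then show ?thesis by (rule has_derivative_eq_rhs) (simp add: fun_eq_iff blinfun.diff_left)
  qed
  have bd: "onorm (?F' z) \<le> \<rho> * norm a" for z
  proof -
    have "dist (hessian h (a + z)) (hessian h z) \<le> \<rho> * dist (a + z) z"
      using lh unfolding lipschitz_hessian_def by (auto dest: lipschitz_onD)
    then show ?thesis by (simp add: dist_norm norm_blinfun.rep_eq)
  qed
  have "norm (?F (u + b) - ?F u) \<le> (\<rho> * norm a) * norm ((u + b) - u)"
    using differentiable_bound[of UNIV ?F ?F' "\<rho> * norm a" "u + b" u] der bd by (simp del: blinfun_apply)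
  then show ?thesis by (simp add: algebra_simps)
qed

text \<open>Difference quotients in the direction \<open>D\<close> itself are at most
  \<open>l * norm D\<close> and converge to \<open>D \<bullet> D\<close>.\<close>

lemma norm_gradient_le_lipschitz:
  fixes h :: "'a::euclidean_space \<Rightarrow> real"
  assumes "GDERIV h x :> D" "l-lipschitz_on UNIV h"
  shows "norm D \<le> l"
proof -
  have "(h has_derivative (\<lambda>v. v \<bullet> D)) (at (x + 0 *\<^sub>R D))"
    using assms(1) unfolding gderiv_def by simp
  then have "((\<lambda>t. h (x + t *\<^sub>R D)) has_derivative (\<lambda>s. (s *\<^sub>R D) \<bullet> D)) (at 0)"
    by (rule has_derivative_compose[rotated]) (auto intro!: derivative_eq_intros)
  then have "DERIV (\<lambda>t. h (x + t *\<^sub>R D)) 0 :> D \<bullet> D"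
    unfolding has_field_derivative_def by (rule has_derivative_eq_rhs) (simp add: fun_eq_iff)
  then have "((\<lambda>t. (h (x + t *\<^sub>R D) - h x) / t) \<longlongrightarrow> D \<bullet> D) (at 0)"
    by (simp add: DERIV_def)
  moreover have "(h (x + t *\<^sub>R D) - h x) / t \<le> l * norm D" for t
  proof -
    have "\<bar>h (x + t *\<^sub>R D) - h x\<bar> \<le> l * (\<bar>t\<bar> * norm D)"
      using lipschitz_onD[OF assms(2), of "x + t *\<^sub>R D" x] by (simp add: dist_norm)
    then have "\<bar>(h (x + t *\<^sub>R D) - h x) / t\<bar> \<le> l * norm D" if "t \<noteq> 0"
      using that by (simp add: abs_divide field_simps)
    \<comment> \<open>At \<open>t = 0\<close> the quotient is \<open>0\<close> by convention, so the
      bound must be nonnegative.\<close>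
    moreover have "0 \<le> l * norm D" using lipschitz_on_nonneg[OF assms(2)] by simp
    ultimately show ?thesis by (cases "t = 0") (simp, linarith)
  qed
  ultimately have "D \<bullet> D \<le> l * norm D"
    by (intro tendsto_upperbound[of _ "D \<bullet> D" "at (0::real)"] always_eventually allI) simp_all
  then have "norm D * norm D \<le> l * norm D"
    by (simp add: dot_square_norm power2_eq_square)
  then show ?thesis using lipschitz_on_nonneg[OF assms(2)] by (cases "D = 0") auto
qed

section \<open>Adaptive gradient methods\<close>

text \<open>The quadratic terms of the descent inequality are either absorbed by the first-order
  decrease or paid from a bounded potential, so that no logarithm arises. The remaining decrease
  dominates the growth of \<open>a\<close>. This bounds \<open>a K\<close>, and the sum of squares
  is \<open>(a K)\<^sup>2 - (a 0)\<^sup>2\<close>.\<close>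

lemma adagrad_norm_bound:
  fixes x d :: "nat \<Rightarrow> 'a::real_inner" and \<phi> :: "'a \<Rightarrow> real"
  assumes quad: "\<And>y z. \<phi> z - \<phi> y - D y \<bullet> (z - y) \<le> L * (norm (z - y))\<^sup>2" and "L > 0"
    and m: "\<And>y. m \<le> \<phi> y" and "a 0 > 0"
    and a: "\<And>k. k < K \<Longrightarrow> a (Suc k) = sqrt ((a k)\<^sup>2 + (norm (d k))\<^sup>2)"
    and x: "\<And>k. k < K \<Longrightarrow> x (Suc k) = x k - (1 / a (Suc k)) *\<^sub>R d k"
    and err: "\<And>k. k < K \<Longrightarrow> (norm (d k - D (x k)))\<^sup>2 \<le> \<eta>"
    and "\<eta> \<ge> 0"
  shows "(\<Sum>k<K. (norm (d k))\<^sup>2)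
    \<le> (a 0 + 4 * (\<phi> (x 0) - m + K * \<eta> / (2 * a 0) + 16 * L ^ 3 / (a 0)\<^sup>2))\<^sup>2"
proof -
  have inv: "a 0 \<le> a k \<and> (\<Sum>i<k. (norm (d i))\<^sup>2) = (a k)\<^sup>2 - (a 0)\<^sup>2 \<and>
      \<phi> (x k) + (a k - a 0) / 4
        \<le> \<phi> (x 0) + k * (\<eta> / (2 * a 0)) + L / (a 0)\<^sup>2 * min ((a k)\<^sup>2) (16 * L\<^sup>2)"
    if "k \<le> K" for k
    using that
  proof (induction k)
    case 0
    then show ?case using \<open>L > 0\<close> by simp
  next
    case (Suc k)
    define A where "A = a k"
    define A' where "A' = a (Suc k)"
    define n where "n = (norm (d k))\<^sup>2"
    \<comment> \<open>This potential pays for the quadratic terms while the step parameter is below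
      \<open>4 * L\<close>; beyond that it is constant, with value
      \<open>16 * L ^ 3 / (a 0)\<^sup>2\<close>.\<close>
    define M where "M t = L / (a 0)\<^sup>2 * min (t\<^sup>2) (16 * L\<^sup>2)" for t
    have IH: "a 0 \<le> A" "(\<Sum>i<k. (norm (d i))\<^sup>2) = A\<^sup>2 - (a 0)\<^sup>2"
      "\<phi> (x k) + (A - a 0) / 4 \<le> \<phi> (x 0) + k * (\<eta> / (2 * a 0)) + M A"
      using Suc by (auto simp: A_def M_def)
    have n: "n \<ge> 0" by (simp add: n_def)
    have A': "A' = sqrt (A\<^sup>2 + n)" using a[of k] Suc by (simp add: A_def A'_def n_def)
    then have A'2: "A'\<^sup>2 = A\<^sup>2 + n" using n by simp
    have "sqrt (A\<^sup>2) \<le> A'" unfolding A' using n by (intro real_sqrt_le_mono) simp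
    then have AA': "A \<le> A'" using IH(1) \<open>a 0 > 0\<close> by simp
    then have pos: "A' > 0" "a 0 \<le> A'" using IH(1) \<open>a 0 > 0\<close> by auto
    \<comment> \<open>Expanding the squared error shows that the inexact direction still correlates
      with the gradient, up to \<open>\<eta>\<close>.\<close>
    have "(norm (d k - D (x k)))\<^sup>2 = n - 2 * (D (x k) \<bullet> d k) + (norm (D (x k)))\<^sup>2"
      unfolding n_def power2_norm_eq_inner by (simp add: inner_diff_left inner_diff_right inner_commute)
    moreover have "(norm (d k - D (x k)))\<^sup>2 \<le> \<eta>" using err Suc by simp
    moreover have "0 \<le> (norm (D (x k)))\<^sup>2" by simp
    ultimately have p: "n - \<eta> \<le> 2 * (D (x k) \<bullet> d k)" by linarith
    have xS: "x (Suc k) - x k = - (1 / A') *\<^sub>R d k" using x Suc by (simp add: A'_def)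
    have "\<phi> (x (Suc k)) \<le> \<phi> (x k) - (D (x k) \<bullet> d k) / A' + L * n / A'\<^sup>2"
      using quad[of "x (Suc k)" "x k"] pos(1) unfolding xS
      by (simp add: power_mult_distrib power_divide n_def)
    moreover have "(n - \<eta>) / (2 * A') \<le> (D (x k) \<bullet> d k) / A'"
      using divide_right_mono[OF p, of "2 * A'"] pos(1) by simp
    moreover have "\<eta> / (2 * A') \<le> \<eta> / (2 * a 0)"
      using pos \<open>a 0 > 0\<close> \<open>\<eta> \<ge> 0\<close> by (intro divide_left_mono) auto
    \<comment> \<open>One of the two copies of \<open>n / (4 * A')\<close> absorbs the quadratic
      term when \<open>A' \<ge> 4 * L\<close>; the other pays for the growth
      \<open>(A' - A) / 4\<close>.\<close>
    moreover have "(n - \<eta>) / (2 * A') = 2 * (n / (4 * A')) - \<eta> / (2 * A')"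
      using pos(1) by (simp add: field_simps)
    moreover have "L * n / A'\<^sup>2 \<le> n / (4 * A') + (M A' - M A)"
    proof (cases "A' \<ge> 4 * L")
      case True
      have "L / A' * (n / A') \<le> 1 / 4 * (n / A')"
        using True n pos(1) by (intro mult_right_mono) (auto simp: field_simps)
      moreover have "M A \<le> M A'"
        unfolding M_def using A'2 n \<open>L > 0\<close> by (intro mult_left_mono min.mono) auto
      ultimately show ?thesis by (simp add: power2_eq_square)
    next
      case False
      then have "A'\<^sup>2 \<le> (4 * L)\<^sup>2" using pos by (intro power_mono) auto
      then have "A'\<^sup>2 \<le> 16 * L\<^sup>2" by (simp add: power_mult_distrib)
      then have "M A' - M A = L * n / (a 0)\<^sup>2"
        using A'2 n unfolding M_def by (simp add: min_def distrib_left add_divide_distrib)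
      moreover have "L * n / A'\<^sup>2 \<le> L * n / (a 0)\<^sup>2"
        using pos \<open>a 0 > 0\<close> \<open>L > 0\<close> n by (intro divide_left_mono power_mono mult_pos_pos) auto
      moreover have "0 \<le> n / (4 * A')" using n pos by simp
      ultimately show ?thesis by linarith
    qed
    moreover have "(A' - A) / 4 \<le> n / (4 * A')"
    proof -
      have "(A' - A) * A' \<le> (A' - A) * (A' + A)" using AA' IH(1) \<open>a 0 > 0\<close> by (intro mult_left_mono) auto
      also have "\<dots> = n" using A'2 by (simp add: power2_eq_square algebra_simps)
      finally show ?thesis using pos by (simp add: field_simps)
    qed
    moreover have "Suc k * (\<eta> / (2 * a 0)) = k * (\<eta> / (2 * a 0)) + \<eta> / (2 * a 0)"
      by (simp only: of_nat_Suc distrib_right mult_1_left add.commute)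
    ultimately have "\<phi> (x (Suc k)) + (A' - a 0) / 4 \<le> \<phi> (x 0) + Suc k * (\<eta> / (2 * a 0)) + M A'"
      using IH(3) unfolding diff_divide_distrib by linarith
    moreover have "(\<Sum>i<Suc k. (norm (d i))\<^sup>2) = A'\<^sup>2 - (a 0)\<^sup>2"
      using IH(2) A'2 by (simp add: n_def)
    ultimately show ?case using pos(2) by (simp add: A'_def M_def)
  qed
  define E where "E = K * \<eta> / (2 * a 0)"
  define F where "F = 16 * L ^ 3 / (a 0)\<^sup>2"
  have "L / (a 0)\<^sup>2 * min ((a K)\<^sup>2) (16 * L\<^sup>2) \<le> L / (a 0)\<^sup>2 * (16 * L\<^sup>2)"
    using \<open>L > 0\<close> by (intro mult_left_mono) auto
  also have "\<dots> = F" by (simp add: F_def power2_eq_square power3_eq_cube)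
  finally have "\<phi> (x K) + (a K - a 0) / 4 \<le> \<phi> (x 0) + E + F"
    using inv[of K] by (simp add: E_def)
  then have "a K \<le> a 0 + 4 * (\<phi> (x 0) - m + E + F)"
    using m[of "x K"] by (simp add: field_simps)
  moreover have "0 \<le> a K" using inv[of K] \<open>a 0 > 0\<close> by simp
  ultimately have "(a K)\<^sup>2 \<le> (a 0 + 4 * (\<phi> (x 0) - m + E + F))\<^sup>2" by (intro power_mono)
  moreover have "(\<Sum>i<K. (norm (d i))\<^sup>2) \<le> (a K)\<^sup>2" using inv[of K] by simp
  ultimately show ?thesis unfolding E_def F_def by linarith
qed

text \<open>The premise serves twice: were the guard never to fail, every \<open>K\<close> would be
  at most \<open>N\<close>; and the first index at which it fails is itself such a
  \<open>K\<close>.\<close>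

lemma while_option_bounded:
  assumes "\<And>K. (\<And>k. k < K \<Longrightarrow> b ((c ^^ k) s)) \<Longrightarrow> real K \<le> N"
  obtains k where "while_option b c s = Some ((c ^^ k) s)" "\<not> b ((c ^^ k) s)" "real k \<le> N"
proof -
  have ex: "\<exists>k. \<not> b ((c ^^ k) s)"
  proof (rule ccontr)
    assume "\<nexists>k. \<not> b ((c ^^ k) s)"
    then have "real K \<le> N" for K using assms by blast
    then show False using reals_Archimedean2[of N] by (meson not_less)
  qed
  define k where "k = (LEAST k. \<not> b ((c ^^ k) s))"
  have "while_option b c s = Some ((c ^^ k) s)" using ex by (simp add: while_option_def k_def)
  moreover have "\<not> b ((c ^^ k) s)" unfolding k_def using ex by (rule LeastI_ex)
  moreover have "real k \<le> N"
  proof (rule assms)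
    show "b ((c ^^ j) s)" if "j < k" for j
      using not_less_Least[of j "\<lambda>k. \<not> b ((c ^^ k) s)"] that unfolding k_def by simp
  qed
  ultimately show ?thesis using that by blast
qed

text \<open>Exact gradients allow \<open>\<eta> = 0\<close> in \<open>adagrad_norm_bound\<close>, so
  the squared gradient norms have a bounded sum, to which each iteration adds at least
  \<open>\<epsilon>\<^sup>2\<close>. The initial gap is at most
  \<open>D\<^sup>2 / (2 * \<mu>)\<close> by PL.\<close>

lemma AdaG_N_correct:
  fixes h :: "'a::euclidean_space \<Rightarrow> real"
  assumes pl: "PL \<mu> h" and lg: "lipschitz_gradient L h" and "\<mu> > 0" "L > 0" "\<alpha>\<^sub>0 > 0" "\<epsilon> > 0"
    and v0: "norm (grad h v\<^sub>0) \<le> D"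
  shows "\<exists>v k. AdaG_N h v\<^sub>0 \<alpha>\<^sub>0 \<epsilon> = Some (v, k) \<and> norm (grad h v) \<le> \<epsilon> \<and>
    real k \<le> (\<alpha>\<^sub>0 + 4 * (D\<^sup>2 / (2 * \<mu>) + 16 * L ^ 3 / \<alpha>\<^sub>0\<^sup>2))\<^sup>2 / \<epsilon>\<^sup>2"
proof -
  let ?C = "\<alpha>\<^sub>0 + 4 * (D\<^sup>2 / (2 * \<mu>) + 16 * L ^ 3 / \<alpha>\<^sub>0\<^sup>2)"
  define b where "b = (\<lambda>(v::'a, \<alpha>::real, k::nat). norm (grad h v) > \<epsilon>)"
  define c where "c = (\<lambda>(v, \<alpha>, k::nat). let \<alpha>' = sqrt (\<alpha>\<^sup>2 + (norm (grad h v))\<^sup>2)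
             in (v - (1 / \<alpha>') *\<^sub>R grad h v, \<alpha>', Suc k))"
  define s where "s k = (c ^^ k) (v\<^sub>0, \<alpha>\<^sub>0, 0)" for k
  define x where "x k = fst (s k)" for k
  define a where "a k = fst (snd (s k))" for k
  have s0: "x 0 = v\<^sub>0" "a 0 = \<alpha>\<^sub>0" by (auto simp: x_def a_def s_def)
  have sS: "a (Suc k) = sqrt ((a k)\<^sup>2 + (norm (grad h (x k)))\<^sup>2)"
    "x (Suc k) = x k - (1 / a (Suc k)) *\<^sub>R grad h (x k)" for k
    by (auto simp: x_def a_def s_def c_def Let_def split: prod.splits)
  have cnt: "snd (snd (s k)) = k" for k
    by (induction k) (auto simp: s_def c_def Let_def split: prod.splits)
  obtain m where m: "\<And>y. m \<le> h y" "\<And>y. 2 * \<mu> * (h y - m) \<le> (norm (grad h y))\<^sup>2"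
    using PL_minimum[OF pl] by metis
  have "(norm (grad h v\<^sub>0))\<^sup>2 \<le> D\<^sup>2" using v0 by (intro power_mono) auto
  then have gap: "h v\<^sub>0 - m \<le> D\<^sup>2 / (2 * \<mu>)"
    using m(2)[of v\<^sub>0] \<open>\<mu> > 0\<close> by (simp add: field_simps)
  have "real K \<le> ?C\<^sup>2 / \<epsilon>\<^sup>2" if K: "\<And>k. k < K \<Longrightarrow> b ((c ^^ k) (v\<^sub>0, \<alpha>\<^sub>0, 0))" for K
  proof -
    have "\<epsilon>\<^sup>2 \<le> (norm (grad h (x k)))\<^sup>2" if "k < K" for k
      using K[OF that] \<open>\<epsilon> > 0\<close> unfolding b_def x_def s_def
      by (intro power_mono) (auto split: prod.splits)
    then have "(\<Sum>k<K. \<epsilon>\<^sup>2) \<le> (\<Sum>k<K. (norm (grad h (x k)))\<^sup>2)" by (intro sum_mono) auto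
    also have "\<dots> \<le> (a 0 + 4 * (h (x 0) - m + real K * 0 / (2 * a 0) + 16 * L ^ 3 / (a 0)\<^sup>2))\<^sup>2"
    proof (rule adagrad_norm_bound[where D = "grad h"])
      show "h z - h y - grad h y \<bullet> (z - y) \<le> L * (norm (z - y))\<^sup>2" for y z
        using lipschitz_gradient_quadratic_bound[OF lg, of z y] by linarith
    qed (simp_all only: sS \<open>L > 0\<close> m(1) s0 \<open>\<alpha>\<^sub>0 > 0\<close> diff_self norm_zero power2_eq_square mult_zero_left order_refl)
    also have "\<dots> \<le> ?C\<^sup>2"
      using gap m(1)[of v\<^sub>0] \<open>\<alpha>\<^sub>0 > 0\<close> \<open>L > 0\<close> by (intro power_mono) (auto simp: s0)
    finally show ?thesis using \<open>\<epsilon> > 0\<close> by (simp add: field_simps)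
  qed
  then obtain k where k: "while_option b c (v\<^sub>0, \<alpha>\<^sub>0, 0) = Some (s k)" "\<not> b (s k)" "real k \<le> ?C\<^sup>2 / \<epsilon>\<^sup>2"
    unfolding s_def by (rule while_option_bounded)
  have "AdaG_N h v\<^sub>0 \<alpha>\<^sub>0 \<epsilon> = Some (x k, k)"
    unfolding AdaG_N_def using k(1) cnt[of k] by (cases "s k") (simp add: b_def c_def x_def)
  moreover have "norm (grad h (x k)) \<le> \<epsilon>" using k(2) by (simp add: b_def x_def split: prod.splits)
  ultimately show ?thesis using k(3) by blast
qed

text \<open>A step at which the local smoothness estimate exceeds \<open>\<alpha> * \<gamma>\<close> may increase the gap by a
  constant factor \<open>B\<close>, but it also multiplies \<open>\<gamma>\<close> by at least \<open>\<alpha>\<close>. With \<open>p = ln (B / q) / ln \<alpha>\<close>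
  the quantity gap \<open>* \<gamma> powr - p\<close> therefore contracts by the factor \<open>q\<close> at every step.\<close>

lemma AC_GM_correct:
  fixes \<mu> L \<alpha> L\<^sub>0 D :: real
  assumes "\<mu> > 0" "L > 0" "\<alpha> > 1" "L\<^sub>0 > 0"
  shows "\<exists>c\<ge>0. \<forall>(h :: 'a::euclidean_space \<Rightarrow> real) v\<^sub>0 \<epsilon>.
    PL \<mu> h \<longrightarrow> lipschitz_gradient L h \<longrightarrow> norm (grad h v\<^sub>0) \<le> D \<longrightarrow> \<epsilon> > 0 \<longrightarrow>
    (\<exists>v k. AC_GM h v\<^sub>0 \<alpha> L\<^sub>0 \<epsilon> = Some (v, k) \<and> norm (grad h v) \<le> \<epsilon> \<and>
       real k \<le> c * (1 + \<bar>ln \<epsilon>\<bar>))"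
proof -
  define M where "M = max L\<^sub>0 (2 * L)"
  \<comment> \<open>The squared gradient is at most \<open>4 * L\<close> times the gap, and step
    sizes are at most \<open>1 / L\<^sub>0\<close>; so a step multiplies the gap by at most
    \<open>B\<close>.\<close>
  define B where "B = 1 + 4 * L\<^sup>2 / L\<^sub>0\<^sup>2"
  \<comment> \<open>The first entry is the contraction factor of a step whose estimate is at most
    \<open>\<alpha> * \<gamma>\<close>; the second keeps \<open>q\<close> positive, so that
    \<open>ln q\<close> makes sense.\<close>
  define q where "q = max (1 - \<mu> / (\<alpha> * M)) (1 / 2)"
  define p where "p = ln (B / q) / ln \<alpha>"
  define C where "C = 4 * L * (M / L\<^sub>0) powr p * (D\<^sup>2 / (2 * \<mu>))"
  \<comment> \<open>The summand \<open>1\<close> is for the last iteration: a guard that holds at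
    index \<open>K - 1\<close> bounds only \<open>K - 1\<close>.\<close>
  define c where "c = 1 + (\<bar>ln C\<bar> + 2) / ln (1 / q)"
  have M: "M > 0" "L\<^sub>0 \<le> M" "2 * L \<le> M" using assms by (auto simp: M_def)
  have B: "B \<ge> 1" using assms by (simp add: B_def)
  have "\<mu> / (\<alpha> * M) > 0" using assms M by simp
  then have q: "q > 0" "q < 1" by (auto simp: q_def)
  have p: "p > 0"
  proof -
    have "B / q > 1" using B q by simp
    then show ?thesis using \<open>\<alpha> > 1\<close> by (simp add: p_def)
  qed
  have \<alpha>p: "\<alpha> powr - p = q / B"
  proof -
    have "\<alpha> powr p = B / q" using \<open>\<alpha> > 1\<close> B q by (simp add: powr_def p_def)
    then show ?thesis by (simp add: powr_minus_divide)
  qed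
  have lnq: "ln (1 / q) > 0" using q by simp
  have c0: "c \<ge> 0" using lnq by (simp add: c_def)
  have "\<exists>v k. AC_GM h v\<^sub>0 \<alpha> L\<^sub>0 \<epsilon> = Some (v, k) \<and> norm (grad h v) \<le> \<epsilon> \<and>
       real k \<le> c * (1 + \<bar>ln \<epsilon>\<bar>)"
    if pl: "PL \<mu> h" and lg: "lipschitz_gradient L h" and v0: "norm (grad h v\<^sub>0) \<le> D" and "\<epsilon> > 0"
    for h :: "'a \<Rightarrow> real" and v\<^sub>0 \<epsilon>
  proof -
    define b where "b = (\<lambda>(v::'a, Ls::real list, k::nat). norm (grad h v) > \<epsilon>)"
    define step where "step = (\<lambda>(v, Ls, k::nat). let \<gamma> = Max (set Ls);
                 v' = v - (1 / (\<alpha> * \<gamma>)) *\<^sub>R grad h v;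
                 L' = 2 * (h v' - h v - grad h v \<bullet> (v' - v)) / (norm (v' - v))\<^sup>2
             in (v', L' # Ls, Suc k))"
    define s where "s k = (step ^^ k) (v\<^sub>0, [L\<^sub>0], 0)" for k
    define x where "x k = fst (s k)" for k
    define Ls where "Ls k = fst (snd (s k))" for k
    define \<gamma> where "\<gamma> k = Max (set (Ls k))" for k
    define l where "l k = 2 * (h (x (Suc k)) - h (x k) - grad h (x k) \<bullet> (x (Suc k) - x k))
      / (norm (x (Suc k) - x k))\<^sup>2" for k
    have s0: "x 0 = v\<^sub>0" "\<gamma> 0 = L\<^sub>0" by (auto simp: x_def \<gamma>_def Ls_def s_def)
    have xS: "x (Suc k) = x k - (1 / (\<alpha> * \<gamma> k)) *\<^sub>R grad h (x k)" for k
      by (auto simp: x_def \<gamma>_def Ls_def s_def step_def Let_def split: prod.splits)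
    have LsS: "Ls (Suc k) = l k # Ls k" for k
      by (auto simp: x_def l_def Ls_def s_def step_def Let_def split: prod.splits)
    have cnt: "snd (snd (s k)) = k" for k
      by (induction k) (auto simp: s_def step_def Let_def split: prod.splits)
    have "Ls k \<noteq> []" for k
      by (cases k) (use LsS in \<open>auto simp: Ls_def s_def\<close>)
    then have \<gamma>S: "\<gamma> (Suc k) = max (l k) (\<gamma> k)" for k
      by (simp add: \<gamma>_def LsS)
    have lL: "l k \<le> 2 * L" for k
    proof (cases "x (Suc k) = x k")
      \<comment> \<open>A zero step makes the estimate \<open>0 / 0\<close>, which is
        \<open>0\<close>.\<close>
      case True
      then show ?thesis using \<open>L > 0\<close> by (simp add: l_def)
    next
      case False
      then show ?thesis
        using lipschitz_gradient_quadratic_bound[OF lg, of "x (Suc k)" "x k"]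
        by (simp add: l_def divide_le_eq)
    qed
    have \<gamma>: "L\<^sub>0 \<le> \<gamma> k \<and> \<gamma> k \<le> M" for k
      by (induction k) (use s0 M lL order_trans[OF lL M(3)] in \<open>auto simp: \<gamma>S le_max_iff_disj\<close>)
    have \<gamma>_pos: "\<gamma> k > 0" for k using \<gamma>[of k] \<open>L\<^sub>0 > 0\<close> by linarith
    obtain m where m: "\<And>y. m \<le> h y" "\<And>y. 2 * \<mu> * (h y - m) \<le> (norm (grad h y))\<^sup>2"
      using PL_minimum[OF pl] by metis
    define r where "r k = h (x k) - m" for k
    have r: "r k \<ge> 0" for k using m(1) by (simp add: r_def)
    have contract: "r (Suc k) * \<gamma> (Suc k) powr - p \<le> q * (r k * \<gamma> k powr - p)" for k
    proof -
      define w where "w = \<alpha> * \<gamma> k"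
      define n where "n = (norm (grad h (x k)))\<^sup>2"
      have n: "n \<ge> 0" by (simp add: n_def)
      have w: "w > 0" "w \<le> \<alpha> * M" "L\<^sub>0 \<le> w"
      proof -
        show "w > 0" using \<gamma>_pos \<open>\<alpha> > 1\<close> by (simp add: w_def)
        show "w \<le> \<alpha> * M" using \<gamma> \<open>\<alpha> > 1\<close> by (simp add: w_def)
        have "1 * \<gamma> k \<le> \<alpha> * \<gamma> k" using \<gamma>_pos[of k] \<open>\<alpha> > 1\<close> by (intro mult_right_mono) auto
        then show "L\<^sub>0 \<le> w" using \<gamma>[of k] by (simp add: w_def)
      qed
      have d: "x (Suc k) - x k = - (1 / w) *\<^sub>R grad h (x k)" by (simp add: xS w_def)
      have inner: "grad h (x k) \<bullet> (x (Suc k) - x k) = - (n / w)"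
        unfolding d n_def by (simp add: power2_norm_eq_inner)
      have sq: "(norm (x (Suc k) - x k))\<^sup>2 = n / w\<^sup>2"
        unfolding d n_def using w(1) by (simp add: power_divide)
      have up: "r (Suc k) \<le> r k - n / w + L * (n / w\<^sup>2)"
        using lipschitz_gradient_quadratic_bound[OF lg, of "x (Suc k)" "x k"]
        unfolding inner sq r_def by linarith
      show ?thesis
      proof (cases "l k \<le> w")
        \<comment> \<open>\<open>l k\<close> is the exact curvature along this step. So
          \<open>l k \<le> w\<close> certifies a decrease of \<open>n / (2 * w)\<close>, even when
          \<open>w\<close> is small compared with \<open>L\<close>, and PL turns it into a
          contraction.\<close>
        case True
        have "2 * (h (x (Suc k)) - h (x k) + n / w) = l k * (n / w\<^sup>2)"
        proof (cases "n = 0")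
          case True
          then have "x (Suc k) = x k" using sq by simp
          then show ?thesis using True by simp
        next
          case False
          then show ?thesis using w(1) unfolding l_def inner sq by simp
        qed
        also have "\<dots> \<le> w * (n / w\<^sup>2)" using True n by (intro mult_right_mono) auto
        also have "\<dots> = n / w" using w by (simp add: power2_eq_square)
        finally have "2 * (h (x (Suc k)) - h (x k) + n / w) \<le> n / w" .
        moreover have "u - m \<le> v - m - t / 2" if "2 * (u - v + t) \<le> t" for u v t :: real
          using that by simp
        ultimately have 1: "r (Suc k) \<le> r k - n / w / 2" unfolding r_def by blast
        have "2 * \<mu> * r k / (\<alpha> * M) \<le> n / (\<alpha> * M)"
          using m(2)[of "x k"] M \<open>\<alpha> > 1\<close> by (intro divide_right_mono) (auto simp: r_def n_def)
        also have "\<dots> \<le> n / w" using w n by (intro divide_left_mono mult_pos_pos) (use M \<open>\<alpha> > 1\<close> in auto)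
        finally have "r (Suc k) \<le> (1 - \<mu> / (\<alpha> * M)) * r k"
          using 1 by (simp add: left_diff_distrib)
        also have "\<dots> \<le> q * r k" using r by (intro mult_right_mono) (auto simp: q_def)
        finally have "r (Suc k) * \<gamma> (Suc k) powr - p \<le> (q * r k) * \<gamma> k powr - p"
          using p \<gamma>_pos r q by (intro mult_mono powr_mono2') (auto simp: \<gamma>S)
        then show ?thesis by (simp add: mult.assoc)
      next
        case False
        then have "w \<le> \<gamma> (Suc k)" by (simp add: \<gamma>S)
        then have "\<gamma> (Suc k) powr - p \<le> w powr - p" using p w by (intro powr_mono2') auto
        also have "\<dots> = q / B * \<gamma> k powr - p"
          using \<gamma>_pos[of k] \<open>\<alpha> > 1\<close> by (simp add: w_def powr_mult \<alpha>p)
        finally have 1: "\<gamma> (Suc k) powr - p \<le> q / B * \<gamma> k powr - p" .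
        have "n / w\<^sup>2 \<le> (4 * L * r k) / L\<^sub>0\<^sup>2"
          using gradient_norm_le_gap[OF lg \<open>L > 0\<close> m(1), of "x k"] w \<open>L\<^sub>0 > 0\<close> n
          by (intro frac_le power_mono) (use r[of k] \<open>L > 0\<close> in \<open>auto simp: n_def r_def\<close>)
        then have "L * (n / w\<^sup>2) \<le> L * ((4 * L * r k) / L\<^sub>0\<^sup>2)" using \<open>L > 0\<close> by (intro mult_left_mono) auto
        moreover have "0 \<le> n / w" using n w by simp
        ultimately have "r (Suc k) \<le> r k + L * ((4 * L * r k) / L\<^sub>0\<^sup>2)" using up by linarith
        also have "\<dots> = B * r k" by (simp add: B_def power2_eq_square distrib_right)
        finally have "r (Suc k) * \<gamma> (Suc k) powr - p \<le> (B * r k) * (q / B * \<gamma> k powr - p)"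
          using 1 r B by (intro mult_mono) auto
        then show ?thesis using B by (simp add: mult_ac)
      qed
    qed
    have decay: "r k * \<gamma> k powr - p \<le> q ^ k * (r 0 * L\<^sub>0 powr - p)" for k
    proof (induction k)
      case (Suc k)
      have "r (Suc k) * \<gamma> (Suc k) powr - p \<le> q * (r k * \<gamma> k powr - p)" by (rule contract)
      also have "\<dots> \<le> q * (q ^ k * (r 0 * L\<^sub>0 powr - p))" using Suc q by (intro mult_left_mono) auto
      finally show ?case by simp
    qed (simp add: s0)
    have grad_decay: "(norm (grad h (x k)))\<^sup>2 \<le> C * q ^ k" for k
    proof -
      have "(norm (grad h v\<^sub>0))\<^sup>2 \<le> D\<^sup>2" using v0 by (intro power_mono) auto
      then have "r 0 \<le> D\<^sup>2 / (2 * \<mu>)"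
        using m(2)[of v\<^sub>0] \<open>\<mu> > 0\<close> by (simp add: r_def s0 field_simps)
      then have "r 0 * L\<^sub>0 powr - p \<le> D\<^sup>2 / (2 * \<mu>) * L\<^sub>0 powr - p" by (intro mult_right_mono) auto
      then have "q ^ k * (r 0 * L\<^sub>0 powr - p) \<le> q ^ k * (D\<^sup>2 / (2 * \<mu>) * L\<^sub>0 powr - p)"
        using q by (intro mult_left_mono) auto
      then have 1: "r k * \<gamma> k powr - p \<le> q ^ k * (D\<^sup>2 / (2 * \<mu>) * L\<^sub>0 powr - p)"
        using decay[of k] by linarith
      \<comment> \<open>As \<open>\<gamma>\<close> stays between \<open>L\<^sub>0\<close> and
        \<open>M\<close>, removing the weight costs only the factor
        \<open>(M / L\<^sub>0) powr p\<close>.\<close>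
      have "r k * M powr - p \<le> r k * \<gamma> k powr - p"
        using r \<gamma>[of k] \<gamma>_pos p by (intro mult_left_mono powr_mono2') auto
      then have "r k * M powr - p * M powr p \<le> q ^ k * (D\<^sup>2 / (2 * \<mu>) * L\<^sub>0 powr - p) * M powr p"
        using 1 by (intro mult_right_mono) auto
      moreover have "r k * M powr - p * M powr p = r k"
        using M by (simp add: powr_minus)
      moreover have "L\<^sub>0 powr - p * M powr p = (M / L\<^sub>0) powr p"
        using M \<open>L\<^sub>0 > 0\<close> by (simp add: powr_divide powr_minus_divide)
      ultimately have "r k \<le> q ^ k * (D\<^sup>2 / (2 * \<mu>) * (M / L\<^sub>0) powr p)"
        by (simp only: mult.assoc)
      then have "4 * L * r k \<le> 4 * L * (q ^ k * (D\<^sup>2 / (2 * \<mu>) * (M / L\<^sub>0) powr p))"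
        using \<open>L > 0\<close> by (intro mult_left_mono) auto
      also have "\<dots> = C * q ^ k" by (simp add: C_def)
      finally show ?thesis
        using gradient_norm_le_gap[OF lg \<open>L > 0\<close> m(1), of "x k"] by (simp add: r_def)
    qed
    have "real K \<le> c * (1 + \<bar>ln \<epsilon>\<bar>)"
      if K: "\<And>k. k < K \<Longrightarrow> b ((step ^^ k) (v\<^sub>0, [L\<^sub>0], 0))" for K
    proof (cases K)
      case 0
      then show ?thesis using c0 by simp
    next
      case (Suc k)
      have "\<epsilon> \<le> norm (grad h (x k))"
        using K[of k] Suc unfolding b_def x_def s_def by (auto split: prod.splits)
      then have "\<epsilon>\<^sup>2 \<le> (norm (grad h (x k)))\<^sup>2" using \<open>\<epsilon> > 0\<close> by (intro power_mono) auto
      then have le: "\<epsilon>\<^sup>2 \<le> C * q ^ k" using grad_decay[of k] by linarith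
      have "0 < C * q ^ k" using le \<open>\<epsilon> > 0\<close> by (smt (verit) zero_less_power)
      then have "C > 0" using q by (simp add: zero_less_mult_iff)
      have "ln (\<epsilon>\<^sup>2) \<le> ln (C * q ^ k)" using le \<open>\<epsilon> > 0\<close> by (subst ln_le_cancel_iff) (use \<open>0 < C * q ^ k\<close> in auto)
      then have "2 * ln \<epsilon> \<le> ln C + k * ln q"
        using \<open>C > 0\<close> q \<open>\<epsilon> > 0\<close> by (simp add: ln_mult ln_realpow)
      then have "k * ln (1 / q) \<le> \<bar>ln C\<bar> + 2 * \<bar>ln \<epsilon>\<bar>" using q by (simp add: ln_div)
      also have "\<dots> \<le> (\<bar>ln C\<bar> + 2) * (1 + \<bar>ln \<epsilon>\<bar>)" by (simp add: algebra_simps)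
      finally have "k \<le> (\<bar>ln C\<bar> + 2) * (1 + \<bar>ln \<epsilon>\<bar>) / ln (1 / q)"
        using lnq by (simp add: pos_le_divide_eq)
      moreover have "c * (1 + \<bar>ln \<epsilon>\<bar>) = (1 + \<bar>ln \<epsilon>\<bar>) + (\<bar>ln C\<bar> + 2) * (1 + \<bar>ln \<epsilon>\<bar>) / ln (1 / q)"
        by (simp add: c_def distrib_right)
      moreover have "real K = 1 + real k" using Suc by simp
      ultimately show ?thesis by linarith
    qed
    then obtain k where k: "while_option b step (v\<^sub>0, [L\<^sub>0], 0) = Some (s k)" "\<not> b (s k)"
        "real k \<le> c * (1 + \<bar>ln \<epsilon>\<bar>)"
      unfolding s_def by (rule while_option_bounded)
    have "AC_GM h v\<^sub>0 \<alpha> L\<^sub>0 \<epsilon> = Some (x k, k)"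
      unfolding AC_GM_def using k(1) cnt[of k] by (cases "s k") (simp add: b_def step_def x_def)
    moreover have "norm (grad h (x k)) \<le> \<epsilon>" using k(2) by (simp add: b_def x_def split: prod.splits)
    ultimately show ?thesis using k(3) by blast
  qed
  then show ?thesis using c0 by blast
qed

section \<open>Value functions of the penalised lower level\<close>

lemma norm_fst_le_norm: "norm (fst u) \<le> norm u"
  by (cases u) (simp add: norm_fst_le)

lemma norm_snd_le_norm: "norm (snd u) \<le> norm u"
  by (cases u) (simp add: norm_snd_le)

lemma GDERIV_section_fst:
  assumes "GDERIV h (x, y) :> D"
  shows "GDERIV (\<lambda>u. h (u, y)) x :> fst D"
proof -
  have "(h has_derivative (\<lambda>v. v \<bullet> D)) (at (x, y))" using assms unfolding gderiv_def .
  then have "((\<lambda>u. h (u, y)) has_derivative (\<lambda>v. (v, 0) \<bullet> D)) (at x)"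
    by (rule has_derivative_compose[rotated]) (auto intro!: derivative_eq_intros)
  then show ?thesis unfolding gderiv_def by (simp add: inner_prod_def)
qed

lemma GDERIV_section_snd:
  assumes "GDERIV h (x, y) :> D"
  shows "GDERIV (\<lambda>v. h (x, v)) y :> snd D"
proof -
  have "(h has_derivative (\<lambda>v. v \<bullet> D)) (at (x, y))" using assms unfolding gderiv_def .
  then have "((\<lambda>u. h (x, u)) has_derivative (\<lambda>v. (0, v) \<bullet> D)) (at y)"
    by (rule has_derivative_compose[rotated]) (auto intro!: derivative_eq_intros)
  then show ?thesis unfolding gderiv_def by (simp add: inner_prod_def)
qed

text \<open>Both \<open>lower_value\<close> and the hyper-objective are shown to be differentiable
  in this way: they are minima rather than compositions of smooth functions, but two-sided quadratic
  bounds are available.\<close>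

lemma GDERIV_of_quadratic_bound:
  fixes h :: "'a::real_inner \<Rightarrow> real"
  assumes "\<And>z. \<bar>h z - h x - D \<bullet> (z - x)\<bar> \<le> C * (norm (z - x))\<^sup>2"
  shows "GDERIV h x :> D"
  unfolding gderiv_def
proof (rule has_derivativeI_sandwich[of 1])
  show "bounded_linear (\<lambda>v. v \<bullet> D)" by (rule bounded_linear_inner_left)
  show "norm (h z - h x - (z - x) \<bullet> D) / norm (z - x) \<le> C * norm (z - x)" if "z \<noteq> x" for z
    using assms[of z] that by (simp add: divide_le_eq power2_eq_square mult.assoc inner_commute)
  have "((\<lambda>z. C * norm (z - x)) \<longlongrightarrow> C * norm (x - x)) (at x)"
    by (intro tendsto_intros)
  then show "((\<lambda>z. C * norm (z - x)) \<longlongrightarrow> 0) (at x)" by simp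
qed simp

lemma outer_iters_bounds:
  assumes "0 < \<epsilon>" "\<epsilon> \<le> 1"
  shows "1 / \<epsilon>\<^sup>2 \<le> real (outer_iters \<epsilon>)" "real (outer_iters \<epsilon>) \<le> 2 / \<epsilon>\<^sup>2" "0 < outer_iters \<epsilon>"
proof -
  have sq: "0 < \<epsilon>\<^sup>2" "\<epsilon>\<^sup>2 \<le> 1" using assms by (auto simp: power_le_one)
  then have "1 \<le> 1 / \<epsilon>\<^sup>2" by simp
  moreover have "real (outer_iters \<epsilon>) = of_int \<lceil>1 / \<epsilon>\<^sup>2\<rceil>"
    unfolding outer_iters_def using sq by (simp add: ceiling_le_iff)
  moreover have "of_int \<lceil>1 / \<epsilon>\<^sup>2\<rceil> < 1 / \<epsilon>\<^sup>2 + 1" "1 / \<epsilon>\<^sup>2 \<le> of_int \<lceil>1 / \<epsilon>\<^sup>2\<rceil>" by linarith+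
  moreover have "2 / \<epsilon>\<^sup>2 = 1 / \<epsilon>\<^sup>2 + 1 / \<epsilon>\<^sup>2" by simp
  ultimately show "1 / \<epsilon>\<^sup>2 \<le> real (outer_iters \<epsilon>)" "real (outer_iters \<epsilon>) \<le> 2 / \<epsilon>\<^sup>2" by linarith+
  then have "0 < real (outer_iters \<epsilon>)" using \<open>1 \<le> 1 / \<epsilon>\<^sup>2\<close> by linarith
  then show "0 < outer_iters \<epsilon>" by simp
qed

text \<open>Landau bounds concern absolute values, so an upper bound on
  \<open>best_grad_norm\<close> needs this companion. The premise makes the \<open>MIN\<close> range
  over a nonempty set.\<close>

lemma best_grad_norm_nonneg:
  assumes "0 < outer_iters \<epsilon>"
  shows "0 \<le> best_grad_norm \<phi> run \<epsilon>"
  unfolding best_grad_norm_def using assms by (subst Min_ge_iff) auto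

section \<open>Penalised objectives and the stability of their minimisers\<close>

locale bilevel_problem =
  fixes f g :: "'a::euclidean_space \<times> 'b::euclidean_space \<Rightarrow> real"
    and \<mu> \<sigma>bar l L_f L_g \<rho> :: real
  assumes mu_pos: "\<mu> > 0" and sbar_pos: "\<sigma>bar > 0" and l_pos: "l > 0"
    and Lf_pos: "L_f > 0" and Lg_pos: "L_g > 0" and rho_pos: "\<rho> > 0"
    and pl: "\<And>\<sigma> x. 0 \<le> \<sigma> \<Longrightarrow> \<sigma> \<le> \<sigma>bar \<Longrightarrow> PL \<mu> (\<lambda>y. \<sigma> * f (x, y) + g (x, y))"
    and lip_f: "l-lipschitz_on UNIV f"
    and lg_f: "lipschitz_gradient L_f f" and lg_g: "lipschitz_gradient L_g g"
    and lh_g: "lipschitz_hessian \<rho> g"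
    and attained: "\<And>x. \<exists>y\<in>lower_argmin g x. \<forall>y'\<in>lower_argmin g x. f (x, y) \<le> f (x, y')"
begin

definition penalized :: "real \<Rightarrow> 'a \<times> 'b \<Rightarrow> real" where
  "penalized s u = s * f u + g u"

definition penalized_grad :: "real \<Rightarrow> 'a \<times> 'b \<Rightarrow> 'a \<times> 'b" where
  "penalized_grad s u = s *\<^sub>R grad f u + grad g u"

text \<open>A smoothness constant shared by \<open>penalized s\<close> for all \<open>s\<close> up
  to \<open>\<sigma>bar\<close>; it makes the inner bounds uniform in the tolerance.\<close>

definition L where "L = L_g + \<sigma>bar * L_f"

text \<open>The constant of \<open>PL_error_bound\<close>.\<close>

definition \<kappa> where "\<kappa> = 4 / \<mu>"

definition lower_value :: "real \<Rightarrow> 'a \<Rightarrow> real" where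
  "lower_value s x = (INF y. penalized s (x, y))"

text \<open>This is W_s, and \<open>lower_value s\<close> is V_s. Being a gradient, it does not
  depend on a choice of minimiser.\<close>

definition value_grad :: "real \<Rightarrow> 'a \<Rightarrow> 'a" where
  "value_grad s x = grad (lower_value s) x"

abbreviation "minimizers s \<equiv> lower_argmin (penalized s)"

lemma constants_pos: "L > 0" "\<kappa> > 0"
  using mu_pos sbar_pos Lf_pos Lg_pos by (auto simp: L_def \<kappa>_def add_pos_pos)

lemma penalized_0 [simp]: "penalized 0 = g" "penalized_grad 0 = grad g"
  by (auto simp: penalized_def penalized_grad_def fun_eq_iff)

lemma GDERIV_penalized: "GDERIV (penalized s) u :> penalized_grad s u"
proof -
  have "GDERIV f u :> grad f u" "GDERIV g u :> grad g u"
    using lipschitz_gradientD(1)[OF lg_f] lipschitz_gradientD(1)[OF lg_g] by auto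
  then have "((\<lambda>u. s * f u + g u) has_derivative (\<lambda>v. s * (v \<bullet> grad f u) + v \<bullet> grad g u)) (at u)"
    unfolding gderiv_def by (intro derivative_intros)
  then show ?thesis
    unfolding gderiv_def penalized_def penalized_grad_def by (simp add: inner_add_right)
qed

lemma penalized_grad_lipschitz:
  assumes "0 \<le> s" "s \<le> \<sigma>bar"
  shows "norm (penalized_grad s u - penalized_grad s v) \<le> L * norm (u - v)"
proof -
  have "penalized_grad s u - penalized_grad s v
      = s *\<^sub>R (grad f u - grad f v) + (grad g u - grad g v)"
    by (simp add: penalized_grad_def scaleR_diff_right)
  then have "norm (penalized_grad s u - penalized_grad s v)
      \<le> s * norm (grad f u - grad f v) + norm (grad g u - grad g v)"
    using norm_triangle_ineq[of "s *\<^sub>R (grad f u - grad f v)" "grad g u - grad g v"] assms by simp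
  also have "\<dots> \<le> \<sigma>bar * (L_f * norm (u - v)) + L_g * norm (u - v)"
    using assms lipschitz_gradientD(2)[OF lg_f] lipschitz_gradientD(2)[OF lg_g]
    by (intro add_mono mult_mono) auto
  finally show ?thesis by (simp add: L_def algebra_simps)
qed

lemma section_grad: "grad (\<lambda>y. penalized s (x, y)) y = snd (penalized_grad s (x, y))"
  by (intro grad_eq GDERIV_section_snd GDERIV_penalized)

lemma section_PL: "0 \<le> s \<Longrightarrow> s \<le> \<sigma>bar \<Longrightarrow> PL \<mu> (\<lambda>y. penalized s (x, y))"
  using pl by (simp add: penalized_def)

lemma section_lipschitz_gradient:
  assumes "0 \<le> s" "s \<le> \<sigma>bar"
  shows "lipschitz_gradient L (\<lambda>y. penalized s (x, y))"
proof (rule lipschitz_gradientI)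
  show "GDERIV (\<lambda>y. penalized s (x, y)) y :> snd (penalized_grad s (x, y))" for y
    by (intro GDERIV_section_snd GDERIV_penalized)
  show "norm (snd (penalized_grad s (x, y)) - snd (penalized_grad s (x, y'))) \<le> L * norm (y - y')" for y y'
    using penalized_grad_lipschitz[OF assms, of "(x, y)" "(x, y')"]
      norm_snd_le_norm[of "penalized_grad s (x, y) - penalized_grad s (x, y')"] by (simp add: norm_Pair snd_diff)
qed (use constants_pos in simp)

lemma minimizer_near:
  assumes "0 \<le> s" "s \<le> \<sigma>bar"
  obtains y' where "y' \<in> minimizers s x" "norm (y' - y) \<le> \<kappa> * norm (snd (penalized_grad s (x, y)))"
proof -
  obtain y' where "\<forall>y''. penalized s (x, y') \<le> penalized s (x, y'')"
    "norm (y' - y) \<le> 4 / \<mu> * norm (grad (\<lambda>y. penalized s (x, y)) y)"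
    by (rule PL_error_bound[OF section_PL[OF assms] mu_pos section_lipschitz_gradient[OF assms]
        constants_pos(1)])
  then show ?thesis using that by (simp add: section_grad \<kappa>_def lower_argmin_def)
qed

text \<open>The gap at a minimiser is zero, and the gap controls the squared gradient.\<close>

lemma minimizer_critical:
  assumes "0 \<le> s" "s \<le> \<sigma>bar" "y \<in> minimizers s x"
  shows "snd (penalized_grad s (x, y)) = 0"
  using gradient_norm_le_gap[OF section_lipschitz_gradient[OF assms(1,2)] constants_pos(1),
      of "penalized s (x, y)" x y] assms(3)
  by (simp add: lower_argmin_def section_grad)

lemma lower_value_eq: "y \<in> minimizers s x \<Longrightarrow> lower_value s x = penalized s (x, y)"
  unfolding lower_value_def lower_argmin_def by (intro cInf_eq_minimum) auto

lemma lower_value_le: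
  assumes "0 \<le> s" "s \<le> \<sigma>bar"
  shows "lower_value s x \<le> penalized s (x, y)"
proof -
  obtain y' where "y' \<in> minimizers s x" using minimizer_near[OF assms] by blast
  then show ?thesis using lower_value_eq by (fastforce simp: lower_argmin_def)
qed

text \<open>At \<open>x'\<close> the old minimiser has a \<open>y\<close>-gradient of at most
  \<open>L * norm (x' - x)\<close>, to which the error bound applies.\<close>

lemma minimizer_stable:
  assumes s: "0 \<le> s" "s \<le> \<sigma>bar" and y: "y \<in> minimizers s x"
  obtains y' where "y' \<in> minimizers s x'" "norm (y' - y) \<le> \<kappa> * L * norm (x' - x)"
proof -
  obtain y' where y': "y' \<in> minimizers s x'" "norm (y' - y) \<le> \<kappa> * norm (snd (penalized_grad s (x', y)))"
    by (rule minimizer_near[OF s])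
  have "norm (snd (penalized_grad s (x', y)))
      = norm (snd (penalized_grad s (x', y) - penalized_grad s (x, y)))"
    using minimizer_critical[OF s y] by (simp add: snd_diff)
  also have "\<dots> \<le> norm (penalized_grad s (x', y) - penalized_grad s (x, y))" by (rule norm_snd_le_norm)
  also have "\<dots> \<le> L * norm (x' - x)"
    using penalized_grad_lipschitz[OF s, of "(x', y)" "(x, y)"] by (simp add: norm_Pair)
  finally have "\<kappa> * norm (snd (penalized_grad s (x', y))) \<le> \<kappa> * (L * norm (x' - x))"
    using constants_pos by (intro mult_left_mono) auto
  then show ?thesis using that y' by (force simp: mult.assoc)
qed

text \<open>Danskin's argument in quantitative form. For the upper bound the old minimiser is tested
  at \<open>x'\<close>. For the lower bound a nearby minimiser at \<open>x'\<close> is expanded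
  around \<open>(x, y)\<close>, where the vanishing \<open>y\<close>-gradient leaves only
  second-order terms.\<close>

lemma lower_value_quadratic_bound:
  assumes s: "0 \<le> s" "s \<le> \<sigma>bar" and y: "y \<in> minimizers s x"
  shows "\<bar>lower_value s x' - lower_value s x - fst (penalized_grad s (x, y)) \<bullet> (x' - x)\<bar>
    \<le> L * (1 + (\<kappa> * L)\<^sup>2) * (norm (x' - x))\<^sup>2"
proof -
  let ?p = "penalized s" and ?d = "fst (penalized_grad s (x, y)) \<bullet> (x' - x)"
  have quad: "\<bar>?p (x', y') - ?p (x, y) - ?d\<bar> \<le> L * ((norm (x' - x))\<^sup>2 + (norm (y' - y))\<^sup>2)" for y'
    using GDERIV_quadratic_bound[OF GDERIV_penalized penalized_grad_lipschitz[OF s], of "(x', y')" "(x, y)"]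
      minimizer_critical[OF s y] by (simp add: inner_prod_def norm_Pair)
  obtain y' where y': "y' \<in> minimizers s x'" "norm (y' - y) \<le> \<kappa> * L * norm (x' - x)"
    by (rule minimizer_stable[OF s y])
  have "(norm (y' - y))\<^sup>2 \<le> (\<kappa> * L * norm (x' - x))\<^sup>2"
    using y'(2) by (intro power_mono) auto
  then have "L * ((norm (x' - x))\<^sup>2 + (norm (y' - y))\<^sup>2)
      \<le> L * ((norm (x' - x))\<^sup>2 + (\<kappa> * L * norm (x' - x))\<^sup>2)"
    using constants_pos by (intro mult_left_mono) auto
  also have "\<dots> = L * (1 + (\<kappa> * L)\<^sup>2) * (norm (x' - x))\<^sup>2"
    by (simp add: power_mult_distrib algebra_simps)
  finally have 1: "L * ((norm (x' - x))\<^sup>2 + (norm (y' - y))\<^sup>2)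
      \<le> L * (1 + (\<kappa> * L)\<^sup>2) * (norm (x' - x))\<^sup>2" .
  moreover have "L * (norm (x' - x))\<^sup>2 \<le> L * ((norm (x' - x))\<^sup>2 + (norm (y' - y))\<^sup>2)"
    using constants_pos by (intro mult_left_mono) auto
  moreover have "lower_value s x' \<le> ?p (x', y)" by (rule lower_value_le[OF s])
  moreover have "\<bar>?p (x', y) - ?p (x, y) - ?d\<bar> \<le> L * (norm (x' - x))\<^sup>2" using quad[of y] by simp
  ultimately show ?thesis
    using quad[of y'] lower_value_eq[OF y] lower_value_eq[OF y'(1)] by linarith
qed

lemma value_grad_eq:
  assumes "0 \<le> s" "s \<le> \<sigma>bar" "y \<in> minimizers s x"
  shows "value_grad s x = fst (penalized_grad s (x, y))"
  unfolding value_grad_def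
  by (rule grad_eq, rule GDERIV_of_quadratic_bound, rule lower_value_quadratic_bound[OF assms])

lemma GDERIV_lower_value:
  assumes "0 \<le> s" "s \<le> \<sigma>bar"
  shows "GDERIV (lower_value s) x :> value_grad s x"
proof -
  obtain y where y: "y \<in> minimizers s x" using minimizer_near[OF assms] by blast
  show ?thesis unfolding value_grad_eq[OF assms y]
    by (rule GDERIV_of_quadratic_bound, rule lower_value_quadratic_bound[OF assms y])
qed

text \<open>At a minimiser within reach of the error bound the formula is exact; moving there
  changes the gradient by at most \<open>L\<close> times the distance.\<close>

lemma value_grad_approx:
  assumes s: "0 \<le> s" "s \<le> \<sigma>bar"
  shows "norm (fst (penalized_grad s (x, y)) - value_grad s x)
    \<le> L * \<kappa> * norm (snd (penalized_grad s (x, y)))"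
proof -
  obtain y' where y': "y' \<in> minimizers s x" "norm (y' - y) \<le> \<kappa> * norm (snd (penalized_grad s (x, y)))"
    by (rule minimizer_near[OF s])
  have "norm (fst (penalized_grad s (x, y)) - value_grad s x)
      = norm (fst (penalized_grad s (x, y) - penalized_grad s (x, y')))"
    by (simp add: value_grad_eq[OF s y'(1)] fst_diff)
  also have "\<dots> \<le> norm (penalized_grad s (x, y) - penalized_grad s (x, y'))" by (rule norm_fst_le_norm)
  also have "\<dots> \<le> L * norm (y' - y)"
    using penalized_grad_lipschitz[OF s, of "(x, y)" "(x, y')"] by (simp add: norm_Pair norm_minus_commute)
  also have "\<dots> \<le> L * (\<kappa> * norm (snd (penalized_grad s (x, y))))"
    using y'(2) constants_pos by (intro mult_left_mono) auto
  finally show ?thesis by (simp add: mult.assoc)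
qed

section \<open>Second differences of the value gradients\<close>

lemma penalized_minimizer_near_minimizer:
  assumes s: "0 \<le> s" "s \<le> \<sigma>bar" and z: "z \<in> minimizers 0 x"
  obtains y where "y \<in> minimizers s x" "norm (y - z) \<le> \<kappa> * l * s"
proof -
  obtain y where y: "y \<in> minimizers s x" "norm (y - z) \<le> \<kappa> * norm (snd (penalized_grad s (x, z)))"
    by (rule minimizer_near[OF s])
  have "snd (penalized_grad 0 (x, z)) = 0"
    using minimizer_critical[OF _ _ z] sbar_pos by simp
  then have "snd (penalized_grad s (x, z)) = s *\<^sub>R snd (grad f (x, z))"
    by (simp add: penalized_grad_def)
  then have "norm (snd (penalized_grad s (x, z))) \<le> s * norm (grad f (x, z))"
    using s norm_snd_le_norm[of "grad f (x, z)"] by (simp add: mult_left_mono)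
  also have "\<dots> \<le> s * l"
    using norm_gradient_le_lipschitz[OF lipschitz_gradientD(1)[OF lg_f] lip_f] s by (intro mult_left_mono) auto
  finally have "\<kappa> * norm (snd (penalized_grad s (x, z))) \<le> \<kappa> * (s * l)"
    using constants_pos by (intro mult_left_mono) auto
  then show ?thesis using that y by (force simp: mult_ac)
qed

text \<open>No differentiability of the minimisers is needed here: the point extrapolated linearly
  from nearby minimisers is a minimiser up to a second-order error, because \<open>grad g\<close> has small
  second differences.\<close>

definition mixed_bound :: real where
  "mixed_bound = (1 + L * \<kappa>) * ((L_f + \<rho> * (\<kappa> * l)) * (1 + \<kappa> * L))"

lemma mixed_bound_nonneg: "mixed_bound \<ge> 0"
  unfolding mixed_bound_def using constants_pos Lf_pos l_pos rho_pos by simp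

lemma value_grad_mixed_difference:
  assumes s: "0 \<le> s" "s \<le> \<sigma>bar"
  shows "norm (value_grad s x' - value_grad s x - value_grad 0 x' + value_grad 0 x)
    \<le> mixed_bound * s * norm (x' - x)"
proof -
  have z0: "0 \<le> (0::real)" "0 \<le> \<sigma>bar" using sbar_pos by auto
  obtain z where z: "z \<in> minimizers 0 x" using minimizer_near[OF z0] by blast
  obtain y where y: "y \<in> minimizers s x" "norm (y - z) \<le> \<kappa> * l * s"
    by (rule penalized_minimizer_near_minimizer[OF s z])
  obtain z' where z': "z' \<in> minimizers 0 x'" "norm (z' - z) \<le> \<kappa> * L * norm (x' - x)"
    by (rule minimizer_stable[OF z0 z])
  \<comment> \<open>The corners \<open>u\<close>, \<open>u + a\<close> and \<open>u + b\<close> of a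
    parallelogram are minimisers, for the parameters \<open>0\<close>, \<open>s\<close> and
    \<open>0\<close>; the fourth corner is the extrapolated point. The sides have lengths of order
    \<open>s\<close> and \<open>norm (x' - x)\<close>, and \<open>E\<close> is of the order of their
    product.\<close>
  define u where "u = (x, z)"
  define a where "a = (0 :: 'a, y - z)"
  define b where "b = (x' - x, z' - z)"
  have pts: "u + a = (x, y)" "u + b = (x', z')" by (auto simp: u_def a_def b_def)
  obtain y' where y': "u + a + b = (x', y')" by (auto simp: u_def a_def b_def)
  define E where "E = penalized_grad s (u + a + b) - penalized_grad s (u + a)
    - penalized_grad 0 (u + b) + penalized_grad 0 u"
  have E': "E = penalized_grad s (x', y') - penalized_grad s (x, y)
      - penalized_grad 0 (x', z') + penalized_grad 0 (x, z)"
    unfolding E_def y' unfolding pts unfolding u_def ..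
  have na: "norm a \<le> \<kappa> * l * s" using y(2) by (simp add: a_def norm_Pair)
  have nb: "norm b \<le> (1 + \<kappa> * L) * norm (x' - x)"
    using norm_Pair_le[of "x' - x" "z' - z"] z'(2) unfolding b_def by (simp add: algebra_simps)
  have "E = s *\<^sub>R (grad f (u + a + b) - grad f (u + a))
      + (grad g (u + a + b) - grad g (u + a) - grad g (u + b) + grad g u)"
    by (simp add: E_def penalized_grad_def algebra_simps)
  then have "norm E \<le> s * norm (grad f (u + a + b) - grad f (u + a))
      + norm (grad g (u + a + b) - grad g (u + a) - grad g (u + b) + grad g u)"
    using norm_triangle_ineq[of "s *\<^sub>R (grad f (u + a + b) - grad f (u + a))"] s by simp
  also have "\<dots> \<le> s * (L_f * norm b) + \<rho> * norm a * norm b"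
    using gradient_second_difference[OF lh_g, of u a b]
      lipschitz_gradientD(2)[OF lg_f, of "u + a + b" "u + a"] s
    by (intro add_mono mult_left_mono) auto
  also have "\<dots> \<le> s * (L_f * norm b) + \<rho> * (\<kappa> * l * s) * norm b"
    using na rho_pos by (intro add_left_mono mult_right_mono mult_left_mono) auto
  also have "\<dots> = s * (L_f + \<rho> * (\<kappa> * l)) * norm b" by (simp add: algebra_simps)
  also have "\<dots> \<le> s * (L_f + \<rho> * (\<kappa> * l)) * ((1 + \<kappa> * L) * norm (x' - x))"
    using nb s Lf_pos rho_pos constants_pos l_pos by (intro mult_left_mono) auto
  finally have nE: "norm E \<le> s * (L_f + \<rho> * (\<kappa> * l)) * ((1 + \<kappa> * L) * norm (x' - x))" .
  \<comment> \<open>Three of the four \<open>y\<close>-gradients in \<open>E\<close> vanish, so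
    \<open>snd E\<close> is the defect of the fourth corner as a minimiser.\<close>
  have sE: "snd (penalized_grad s (x', y')) = snd E"
    using minimizer_critical[OF z0 z] minimizer_critical[OF z0 z'(1)] minimizer_critical[OF s y(1)]
    unfolding E' by (simp add: snd_diff)
  have "value_grad s x' - value_grad s x - value_grad 0 x' + value_grad 0 x
      = fst E - (fst (penalized_grad s (x', y')) - value_grad s x')"
    using value_grad_eq[OF z0 z] value_grad_eq[OF z0 z'(1)] value_grad_eq[OF s y(1)]
    unfolding E' by (simp add: fst_diff)
  then have "norm (value_grad s x' - value_grad s x - value_grad 0 x' + value_grad 0 x)
      \<le> norm (fst E) + norm (fst (penalized_grad s (x', y')) - value_grad s x')"
    using norm_triangle_ineq4 by metis
  also have "\<dots> \<le> norm E + L * \<kappa> * norm E"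
    using value_grad_approx[OF s, of x' y'] norm_fst_le_norm[of E] norm_snd_le_norm[of E] constants_pos
    unfolding sE by (smt (verit) mult_left_mono mult_pos_pos)
  also have "\<dots> = (1 + L * \<kappa>) * norm E" by (simp add: algebra_simps)
  also have "\<dots> \<le> (1 + L * \<kappa>) * (s * (L_f + \<rho> * (\<kappa> * l)) * ((1 + \<kappa> * L) * norm (x' - x)))"
    using nE constants_pos by (intro mult_left_mono) auto
  finally show ?thesis by (simp add: mixed_bound_def mult_ac)
qed

definition doubling_bound :: real where
  "doubling_bound = (1 + L * \<kappa>) * (2 * L_f * (\<kappa> * l) + \<rho> * (\<kappa> * l)\<^sup>2)"

lemma doubling_bound_nonneg: "doubling_bound \<ge> 0"
  unfolding doubling_bound_def using constants_pos Lf_pos l_pos rho_pos by simp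

text \<open>The parallelogram degenerates: both sides are \<open>a\<close>, of order
  \<open>s\<close>, and \<open>u + a + a\<close> is an approximate minimiser for the parameter
  \<open>2 * s\<close>. The \<open>f\<close> terms and the second difference of
  \<open>grad g\<close> are both of order \<open>s\<^sup>2\<close>.\<close>

lemma value_grad_doubling:
  assumes s: "0 \<le> s" "2 * s \<le> \<sigma>bar"
  shows "norm (value_grad (2 * s) x - 2 *\<^sub>R value_grad s x + value_grad 0 x) \<le> doubling_bound * s\<^sup>2"
proof -
  have z0: "0 \<le> (0::real)" "0 \<le> \<sigma>bar" using sbar_pos by auto
  have s1: "0 \<le> s" "s \<le> \<sigma>bar" and s2: "0 \<le> 2 * s" "2 * s \<le> \<sigma>bar" using s by auto
  obtain z where z: "z \<in> minimizers 0 x" using minimizer_near[OF z0] by blast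
  obtain y where y: "y \<in> minimizers s x" "norm (y - z) \<le> \<kappa> * l * s"
    by (rule penalized_minimizer_near_minimizer[OF s1 z])
  define u where "u = (x, z)"
  define a where "a = (0 :: 'a, y - z)"
  have pts: "u + a = (x, y)" by (auto simp: u_def a_def)
  obtain y' where y': "u + a + a = (x, y')" by (auto simp: u_def a_def)
  define E where "E = penalized_grad (2 * s) (u + a + a) - 2 *\<^sub>R penalized_grad s (u + a)
    + penalized_grad 0 u"
  have E': "E = penalized_grad (2 * s) (x, y') - 2 *\<^sub>R penalized_grad s (x, y)
      + penalized_grad 0 (x, z)"
    unfolding E_def y' unfolding pts unfolding u_def ..
  have na: "norm a \<le> \<kappa> * l * s" using y(2) by (simp add: a_def norm_Pair)
  have "E = (2 * s) *\<^sub>R (grad f (u + a + a) - grad f (u + a))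
      + (grad g (u + a + a) - grad g (u + a) - grad g (u + a) + grad g u)"
    by (simp add: E_def penalized_grad_def algebra_simps scaleR_2)
  then have "norm E \<le> (2 * s) * norm (grad f (u + a + a) - grad f (u + a))
      + norm (grad g (u + a + a) - grad g (u + a) - grad g (u + a) + grad g u)"
    using norm_triangle_ineq[of "(2 * s) *\<^sub>R (grad f (u + a + a) - grad f (u + a))"] s by simp
  also have "\<dots> \<le> (2 * s) * (L_f * norm a) + \<rho> * norm a * norm a"
    using gradient_second_difference[OF lh_g, of u a a]
      lipschitz_gradientD(2)[OF lg_f, of "u + a + a" "u + a"] s
    by (intro add_mono mult_left_mono) auto
  also have "\<dots> \<le> (2 * s) * (L_f * (\<kappa> * l * s)) + \<rho> * (\<kappa> * l * s) * (\<kappa> * l * s)"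
    using na rho_pos s Lf_pos constants_pos l_pos by (intro add_mono mult_mono mult_nonneg_nonneg) auto
  also have "\<dots> = (2 * L_f * (\<kappa> * l) + \<rho> * (\<kappa> * l)\<^sup>2) * s\<^sup>2"
    by (simp add: algebra_simps power2_eq_square)
  finally have nE: "norm E \<le> (2 * L_f * (\<kappa> * l) + \<rho> * (\<kappa> * l)\<^sup>2) * s\<^sup>2" .
  have sE: "snd (penalized_grad (2 * s) (x, y')) = snd E"
    using minimizer_critical[OF z0 z] minimizer_critical[OF s1 y(1)]
    unfolding E' by (simp add: snd_diff)
  have "value_grad (2 * s) x - 2 *\<^sub>R value_grad s x + value_grad 0 x
      = fst E - (fst (penalized_grad (2 * s) (x, y')) - value_grad (2 * s) x)"
    using value_grad_eq[OF z0 z] value_grad_eq[OF s1 y(1)]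
    unfolding E' by (simp add: fst_diff)
  then have "norm (value_grad (2 * s) x - 2 *\<^sub>R value_grad s x + value_grad 0 x)
      \<le> norm (fst E) + norm (fst (penalized_grad (2 * s) (x, y')) - value_grad (2 * s) x)"
    using norm_triangle_ineq4 by metis
  also have "\<dots> \<le> norm E + L * \<kappa> * norm E"
    using value_grad_approx[OF s2, of x y'] norm_fst_le_norm[of E] norm_snd_le_norm[of E] constants_pos
    unfolding sE by (smt (verit) mult_left_mono mult_pos_pos)
  also have "\<dots> = (1 + L * \<kappa>) * norm E" by (simp add: algebra_simps)
  also have "\<dots> \<le> (1 + L * \<kappa>) * ((2 * L_f * (\<kappa> * l) + \<rho> * (\<kappa> * l)\<^sup>2) * s\<^sup>2)"
    using nE constants_pos by (intro mult_left_mono) auto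
  finally show ?thesis by (simp add: doubling_bound_def mult_ac)
qed

subsection \<open>The hyper-objective\<close>

abbreviation \<phi> where "\<phi> \<equiv> hyper_objective f g"

definition penalty :: "real \<Rightarrow> 'a \<Rightarrow> real" where
  "penalty s x = (lower_value s x - lower_value 0 x) / s"

definition penalty_grad :: "real \<Rightarrow> 'a \<Rightarrow> 'a" where
  "penalty_grad s x = (1 / s) *\<^sub>R (value_grad s x - value_grad 0 x)"

lemma zero_le_sbar: "0 \<le> (0::real)" "0 \<le> \<sigma>bar"
  using sbar_pos by auto

text \<open>For the upper bound, \<open>penalized s\<close> is tested at the lower-level solution
  with least \<open>f\<close>. For the lower bound, the \<open>y\<close>-gradient of
  \<open>g\<close> at a penalised minimiser is \<open>- s\<close> times that of \<open>f\<close>;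
  hence a lower-level solution lies within \<open>\<kappa> * l * s\<close>, and \<open>f\<close>
  varies by at most \<open>l\<close> times this distance.\<close>

lemma penalty_near_hyper_objective:
  assumes s: "0 < s" "s \<le> \<sigma>bar"
  shows "\<bar>penalty s x - \<phi> x\<bar> \<le> l * (\<kappa> * l) * s"
proof -
  have s': "0 \<le> s" using s by simp
  obtain z where z: "z \<in> lower_argmin g x" "\<forall>z'\<in>lower_argmin g x. f (x, z) \<le> f (x, z')"
    using attained[of x] by blast
  have \<phi>: "\<phi> x = f (x, z)"
    unfolding hyper_objective_def using z by (intro cInf_eq_minimum) auto
  have v0: "lower_value 0 x = g (x, z)" using lower_value_eq[of z 0 x] z by simp
  have "lower_value s x \<le> s * f (x, z) + g (x, z)"
    using lower_value_le[OF s' s(2), of x z] by (simp add: penalized_def)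
  then have "penalty s x \<le> \<phi> x"
    using s(1) by (simp add: penalty_def v0 \<phi> divide_le_eq mult.commute)
  moreover have "\<phi> x - l * (\<kappa> * l) * s \<le> penalty s x"
  proof -
    obtain y where y: "y \<in> minimizers s x" using minimizer_near[OF s' s(2)] by blast
    have gy: "snd (grad g (x, y)) = - s *\<^sub>R snd (grad f (x, y))"
      using minimizer_critical[OF s' s(2) y] by (simp add: penalized_grad_def eq_neg_iff_add_eq_0 add.commute)
    obtain z' where z': "z' \<in> minimizers 0 x" "norm (z' - y) \<le> \<kappa> * norm (snd (penalized_grad 0 (x, y)))"
      by (rule minimizer_near[OF zero_le_sbar])
    have "norm (snd (grad f (x, y))) \<le> l"
      using norm_snd_le_norm[of "grad f (x, y)"]
        norm_gradient_le_lipschitz[OF lipschitz_gradientD(1)[OF lg_f] lip_f, of "(x, y)"] by linarith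
    then have "\<kappa> * norm (snd (penalized_grad 0 (x, y))) \<le> \<kappa> * (s * l)"
      using gy s constants_pos by (intro mult_left_mono) auto
    then have d: "norm (z' - y) \<le> \<kappa> * l * s" using z'(2) by (simp add: mult_ac)
    have "\<bar>f (x, z') - f (x, y)\<bar> \<le> l * norm (z' - y)"
      using lipschitz_onD[OF lip_f, of "(x, z')" "(x, y)"] by (simp add: dist_norm norm_Pair)
    also have "\<dots> \<le> l * (\<kappa> * l * s)" using d l_pos by (intro mult_left_mono) auto
    finally have "f (x, z') - f (x, y) \<le> l * (\<kappa> * l * s)" by linarith
    moreover have "f (x, z) \<le> f (x, z')" using z z'(1) by simp
    ultimately have "\<phi> x - l * (\<kappa> * l) * s \<le> f (x, y)" by (simp add: \<phi> mult.assoc)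
    then have "s * (\<phi> x - l * (\<kappa> * l) * s) \<le> s * f (x, y)" using s by (intro mult_left_mono) auto
    also have "\<dots> \<le> lower_value s x - lower_value 0 x"
      using lower_value_le[OF zero_le_sbar, of x y] lower_value_eq[OF y] by (simp add: penalized_def)
    finally show ?thesis using s by (simp add: penalty_def le_divide_eq mult.commute)
  qed
  ultimately show ?thesis using l_pos constants_pos s by (simp add: abs_le_iff)
qed

text \<open>The factor \<open>s\<close> in \<open>value_grad_mixed_difference\<close> cancels the
  division by \<open>s\<close>. The constant is then the same for all \<open>s\<close>, which lets
  the bound survive the limit.\<close>

lemma penalty_quadratic_bound:
  assumes s: "0 < s" "s \<le> \<sigma>bar"
  shows "\<bar>penalty s x' - penalty s x - penalty_grad s x \<bullet> (x' - x)\<bar> \<le> mixed_bound * (norm (x' - x))\<^sup>2"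
proof (rule GDERIV_quadratic_bound)
  have s': "0 \<le> s" using s by simp
  show "GDERIV (penalty s) x :> penalty_grad s x" for x
  proof -
    have "(lower_value s has_derivative (\<lambda>v. v \<bullet> value_grad s x)) (at x)"
      "(lower_value 0 has_derivative (\<lambda>v. v \<bullet> value_grad 0 x)) (at x)"
      using GDERIV_lower_value[OF s' s(2)] GDERIV_lower_value[OF zero_le_sbar] unfolding gderiv_def by auto
    then have "((\<lambda>x. (1 / s) * (lower_value s x - lower_value 0 x)) has_derivative
        (\<lambda>v. (1 / s) * (v \<bullet> value_grad s x - v \<bullet> value_grad 0 x))) (at x)"
      by (intro has_derivative_mult_right has_derivative_diff)
    then show ?thesis unfolding gderiv_def penalty_def[abs_def] penalty_grad_def
      by (simp add: inner_diff_right)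
  qed
  show "norm (penalty_grad s x - penalty_grad s y) \<le> mixed_bound * norm (x - y)" for x y
  proof -
    have "penalty_grad s x - penalty_grad s y
        = (1 / s) *\<^sub>R (value_grad s x - value_grad s y - value_grad 0 x + value_grad 0 y)"
      by (simp add: penalty_grad_def algebra_simps)
    then have "norm (penalty_grad s x - penalty_grad s y)
        = norm (value_grad s x - value_grad s y - value_grad 0 x + value_grad 0 y) / s"
      using s by simp
    also have "\<dots> \<le> (mixed_bound * s * norm (x - y)) / s"
      using value_grad_mixed_difference[OF s' s(2)] s by (intro divide_right_mono) auto
    finally show ?thesis using s by simp
  qed
qed

text \<open>The difference is, up to sign, the second difference of \<open>value_grad\<close> in the
  parameter divided by \<open>s\<close>; order \<open>s\<^sup>2\<close> becomes order
  \<open>s\<close>, which is summable under repeated halving.\<close>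

lemma penalty_grad_halving:
  assumes s: "0 < s" "s \<le> \<sigma>bar"
  shows "norm (penalty_grad (s / 2) x - penalty_grad s x) \<le> doubling_bound * s / 4"
proof -
  define t where "t = s / 2"
  have t: "0 < t" "0 \<le> t" "2 * t \<le> \<sigma>bar" "s = 2 * t" using s by (auto simp: t_def)
  have "penalty_grad t x - penalty_grad s x
      = (- 1 / (2 * t)) *\<^sub>R (value_grad (2 * t) x - 2 *\<^sub>R value_grad t x + value_grad 0 x)"
  proof -
    have "(1 / t) *\<^sub>R v = (1 / (2 * t)) *\<^sub>R (2 *\<^sub>R v)" for v :: 'a by simp
    then show ?thesis
      unfolding penalty_grad_def t(4) by (simp add: algebra_simps scaleR_2)
  qed
  then have "norm (penalty_grad t x - penalty_grad s x)
      = norm (value_grad (2 * t) x - 2 *\<^sub>R value_grad t x + value_grad 0 x) / (2 * t)"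
    using t(1) by simp
  also have "\<dots> \<le> (doubling_bound * t\<^sup>2) / (2 * t)"
    using value_grad_doubling[OF t(2,3)] t(1) by (intro divide_right_mono) auto
  also have "\<dots> = doubling_bound * s / 4" using t by (simp add: power2_eq_square)
  finally show ?thesis by (simp add: t_def)
qed

lemma penalty_grad_limit:
  assumes s: "0 < s" "s \<le> \<sigma>bar"
  obtains b where "(\<lambda>n. penalty_grad (s / 2 ^ n) x) \<longlonglongrightarrow> b"
    "norm (b - penalty_grad s x) \<le> doubling_bound * s"
proof -
  define X where "X n = penalty_grad (s / 2 ^ n) x" for n
  \<comment> \<open>The increments sum to at most \<open>2 * c\<close>, half of the bound
    claimed.\<close>
  define c where "c = doubling_bound * s / 4"
  have step: "norm (X (Suc n) - X n) \<le> c * (1 / 2) ^ n" for n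
  proof -
    have "s / 2 ^ n \<le> s" using s by (simp add: divide_le_eq)
    then have "norm (penalty_grad (s / 2 ^ n / 2) x - penalty_grad (s / 2 ^ n) x)
        \<le> doubling_bound * (s / 2 ^ n) / 4"
      using s by (intro penalty_grad_halving) auto
    then show ?thesis by (simp add: X_def c_def power_one_over field_simps)
  qed
  have geo: "summable (\<lambda>n. c * (1 / 2) ^ n)" "(\<Sum>n. c * (1 / 2 :: real) ^ n) = 2 * c"
    by (auto simp: summable_geometric suminf_mult suminf_geometric)
  have sumn: "summable (\<lambda>n. norm (X (Suc n) - X n))"
    using step by (intro summable_comparison_test'[OF geo(1)]) auto
  then have sum: "summable (\<lambda>n. X (Suc n) - X n)" by (rule summable_norm_cancel)
  define b where "b = X 0 + (\<Sum>n. X (Suc n) - X n)"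
  have "(\<lambda>N. X 0 + (\<Sum>n<N. X (Suc n) - X n)) \<longlonglongrightarrow> b"
    unfolding b_def using sum by (intro tendsto_intros summable_LIMSEQ)
  then have lim: "X \<longlonglongrightarrow> b" by (simp add: sum_lessThan_telescope)
  have "norm (b - X 0) \<le> (\<Sum>n. norm (X (Suc n) - X n))"
    unfolding b_def using summable_norm[OF sumn] by simp
  also have "\<dots> \<le> 2 * c"
    using suminf_le[OF step sumn geo(1)] geo(2) by simp
  also have "\<dots> \<le> doubling_bound * s" using doubling_bound_nonneg s by (simp add: c_def)
  finally have "norm (b - penalty_grad s x) \<le> doubling_bound * s" by (simp add: X_def)
  then show ?thesis using that lim unfolding X_def[abs_def] by blast
qed

text \<open>Along \<open>s / 2 ^ n\<close> the penalties converge to \<open>\<phi>\<close> and their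
  gradients to some \<open>b\<close>, so the uniform quadratic bound passes to the limit. The
  limiting bound makes \<open>\<phi>\<close> differentiable and identifies \<open>b\<close> as its
  gradient.\<close>

lemma hyper_objective_smooth:
  assumes s: "0 < s" "s \<le> \<sigma>bar"
  shows "norm (penalty_grad s x - grad \<phi> x) \<le> doubling_bound * s"
    and "\<bar>\<phi> x' - \<phi> x - grad \<phi> x \<bullet> (x' - x)\<bar> \<le> mixed_bound * (norm (x' - x))\<^sup>2"
proof -
  obtain b where b: "(\<lambda>n. penalty_grad (s / 2 ^ n) x) \<longlonglongrightarrow> b"
    "norm (b - penalty_grad s x) \<le> doubling_bound * s"
    by (rule penalty_grad_limit[OF s])
  have sn: "0 < s / 2 ^ n" "s / 2 ^ n \<le> \<sigma>bar" for n
  proof -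
    have "s / 2 ^ n \<le> s" using s by (simp add: divide_le_eq)
    then show "0 < s / 2 ^ n" "s / 2 ^ n \<le> \<sigma>bar" using s by auto
  qed
  have lim: "(\<lambda>n. penalty (s / 2 ^ n) z) \<longlonglongrightarrow> \<phi> z" for z
  proof (rule LIM_zero_cancel, rule tendsto_rabs_zero_cancel,
      rule tendsto_sandwich[of "\<lambda>_. 0" _ _ "\<lambda>n. l * (\<kappa> * l) * s * (1 / 2) ^ n"])
    have "\<bar>penalty (s / 2 ^ n) z - \<phi> z\<bar> \<le> l * (\<kappa> * l) * s * (1 / 2) ^ n" for n
      using penalty_near_hyper_objective[OF sn, of n z] by (simp add: power_one_over)
    then show "\<forall>\<^sub>F n in sequentially. \<bar>penalty (s / 2 ^ n) z - \<phi> z\<bar> \<le> l * (\<kappa> * l) * s * (1 / 2) ^ n"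
      by simp
    have "(\<lambda>n. l * (\<kappa> * l) * s * (1 / 2 :: real) ^ n) \<longlonglongrightarrow> l * (\<kappa> * l) * s * 0"
      by (intro tendsto_intros LIMSEQ_realpow_zero) auto
    then show "(\<lambda>n. l * (\<kappa> * l) * s * (1 / 2 :: real) ^ n) \<longlonglongrightarrow> 0" by simp
  qed auto
  have quad: "\<bar>\<phi> z - \<phi> x - b \<bullet> (z - x)\<bar> \<le> mixed_bound * (norm (z - x))\<^sup>2" for z
  proof (rule tendsto_upperbound)
    show "(\<lambda>n. \<bar>penalty (s / 2 ^ n) z - penalty (s / 2 ^ n) x - penalty_grad (s / 2 ^ n) x \<bullet> (z - x)\<bar>)
        \<longlonglongrightarrow> \<bar>\<phi> z - \<phi> x - b \<bullet> (z - x)\<bar>"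
      by (intro tendsto_intros lim b(1))
    show "\<forall>\<^sub>F n in sequentially. \<bar>penalty (s / 2 ^ n) z - penalty (s / 2 ^ n) x
        - penalty_grad (s / 2 ^ n) x \<bullet> (z - x)\<bar> \<le> mixed_bound * (norm (z - x))\<^sup>2"
      by (intro always_eventually allI penalty_quadratic_bound sn)
  qed simp
  have "grad \<phi> x = b" by (rule grad_eq, rule GDERIV_of_quadratic_bound, rule quad)
  then show "norm (penalty_grad s x - grad \<phi> x) \<le> doubling_bound * s"
    "\<bar>\<phi> x' - \<phi> x - grad \<phi> x \<bullet> (x' - x)\<bar> \<le> mixed_bound * (norm (x' - x))\<^sup>2"
    using b(2) quad[of x'] by (simp_all add: norm_minus_commute[of "penalty_grad s x"])
qed

text \<open>The computed direction is \<open>penalty_grad s x\<close> with approximate minimisers in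
  place of exact ones. Each replacement costs \<open>L * \<kappa> * \<delta>\<close>, divided by
  \<open>s\<close>; the last term is the bias of the penalty itself.\<close>

lemma hypergradient_error:
  assumes s: "0 < s" "s \<le> \<sigma>bar"
    and y: "norm (snd (penalized_grad s (x, y))) \<le> \<delta>"
    and z: "norm (snd (penalized_grad 0 (x, z))) \<le> \<delta>"
  shows "norm (grad (\<lambda>u. f (u, y)) x +
              (1 / s) *\<^sub>R (grad (\<lambda>u. g (u, y)) x - grad (\<lambda>u. g (u, z)) x) - grad \<phi> x)
    \<le> 2 * L * \<kappa> * \<delta> / s + doubling_bound * s"
proof -
  have s': "0 \<le> s" using s by simp
  let ?d = "grad (\<lambda>u. f (u, y)) x + (1 / s) *\<^sub>R (grad (\<lambda>u. g (u, y)) x - grad (\<lambda>u. g (u, z)) x)"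
  let ?P = "fst (penalized_grad s (x, y)) - value_grad s x"
  let ?Q = "fst (penalized_grad 0 (x, z)) - value_grad 0 x"
  have "grad (\<lambda>u. f (u, y)) x = fst (grad f (x, y))"
    by (intro grad_eq GDERIV_section_fst lipschitz_gradientD(1)[OF lg_f])
  moreover have "grad (\<lambda>u. g (u, w)) x = fst (grad g (x, w))" for w
    by (intro grad_eq GDERIV_section_fst lipschitz_gradientD(1)[OF lg_g])
  ultimately have d: "?d - penalty_grad s x = (1 / s) *\<^sub>R (?P - ?Q)"
    using s by (simp add: penalty_grad_def penalized_grad_def algebra_simps)
  have "norm (?P - ?Q) \<le> norm ?P + norm ?Q" by (rule norm_triangle_ineq4)
  also have "\<dots> \<le> L * \<kappa> * \<delta> + L * \<kappa> * \<delta>"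
  proof (rule add_mono)
    have "L * \<kappa> * norm (snd (penalized_grad s (x, y))) \<le> L * \<kappa> * \<delta>"
      "L * \<kappa> * norm (snd (penalized_grad 0 (x, z))) \<le> L * \<kappa> * \<delta>"
      using y z constants_pos by (auto intro!: mult_left_mono)
    then show "norm ?P \<le> L * \<kappa> * \<delta>" "norm ?Q \<le> L * \<kappa> * \<delta>"
      using value_grad_approx[OF s' s(2), of x y] value_grad_approx[OF zero_le_sbar, of x z] by linarith+
  qed
  also have "\<dots> = 2 * L * \<kappa> * \<delta>" by simp
  finally have "norm (?P - ?Q) / s \<le> (2 * L * \<kappa> * \<delta>) / s" using s by (intro divide_right_mono) auto
  moreover have "norm (?d - penalty_grad s x) = norm (?P - ?Q) / s" unfolding d using s by simp
  ultimately have "norm (?d - penalty_grad s x) \<le> 2 * L * \<kappa> * \<delta> / s" by linarith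
  moreover have "norm (?d - grad \<phi> x) \<le> norm (?d - penalty_grad s x) + norm (penalty_grad s x - grad \<phi> x)"
    using norm_triangle_ineq[of "?d - penalty_grad s x" "penalty_grad s x - grad \<phi> x"] by simp
  ultimately show ?thesis using hyper_objective_smooth(1)[OF s, of x] by linarith
qed

subsection \<open>The bilevel iteration\<close>

text \<open>The interface through which both inner solvers enter the outer analysis.
  \<open>N\<close> is uniform over \<open>h\<close>, because all inner objectives share
  \<open>\<mu>\<close> and \<open>L\<close>.\<close>

definition solves ::
    "(('b \<Rightarrow> real) \<Rightarrow> 'b \<Rightarrow> ('b \<times> nat) option) \<Rightarrow> real \<Rightarrow> real \<Rightarrow> real \<Rightarrow> bool" where
  "solves solve D \<delta> N \<longleftrightarrow>
     (\<forall>h v. PL \<mu> h \<longrightarrow> lipschitz_gradient L h \<longrightarrow> norm (grad h v) \<le> D \<longrightarrow>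
        (\<exists>v' k. solve h v = Some (v', k) \<and> norm (grad h v') \<le> \<delta> \<and> real k \<le> N))"

lemma solvesD:
  "solves solve D \<delta> N \<Longrightarrow> PL \<mu> h \<Longrightarrow> lipschitz_gradient L h \<Longrightarrow> norm (grad h v) \<le> D \<Longrightarrow>
    \<exists>v' k. solve h v = Some (v', k) \<and> norm (grad h v') \<le> \<delta> \<and> real k \<le> N"
  unfolding solves_def by blast

lemma solves_mono: "solves solve D \<delta> N \<Longrightarrow> N \<le> N' \<Longrightarrow> solves solve D \<delta> N'"
  unfolding solves_def by (meson order_trans)

text \<open>The loop invariant that keeps the inner runs short. It constrains gradients only, as the
  points themselves may drift.\<close>

definition warm :: "real \<Rightarrow> real \<Rightarrow> ('a, 'b) bilevel_state \<Rightarrow> bool" where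
  "warm s D st \<longleftrightarrow> a_par st > 0 \<and>
     norm (snd (penalized_grad 0 (x_pt st, z_pt st))) \<le> D \<and>
     norm (snd (penalized_grad s (x_pt st, y_pt st))) \<le> D"

lemma bilevel_step_correct:
  assumes s: "0 < s" "s \<le> \<sigma>bar" and solve: "solves solve_z D \<delta> N" "solves solve_y D \<delta> N"
    and "\<delta> \<le> 1" "1 + L \<le> D" and warm: "warm s D st"
  obtains st' d where "bilevel_step solve_z solve_y f g s st = Some st'" "warm s D st'"
    "a_par st' = sqrt ((a_par st)\<^sup>2 + (norm d)\<^sup>2)" "x_pt st' = x_pt st - (1 / a_par st') *\<^sub>R d"
    "norm (d - grad \<phi> (x_pt st)) \<le> 2 * L * \<kappa> * \<delta> / s + doubling_bound * s"
    "real (calls st') \<le> real (calls st) + (3 * N + 6)"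
proof -
  define x where "x = x_pt st"
  have s': "0 \<le> s" using s by simp
  have w: "a_par st > 0" "norm (snd (penalized_grad 0 (x, z_pt st))) \<le> D"
    "norm (snd (penalized_grad s (x, y_pt st))) \<le> D"
    using warm by (auto simp: warm_def x_def)
  have gz: "grad (\<lambda>y. g (x, y)) v = snd (penalized_grad 0 (x, v))" for v
    using section_grad[of 0 x v] by simp
  have "\<exists>z K. solve_z (\<lambda>y. g (x, y)) (z_pt st) = Some (z, K) \<and>
      norm (grad (\<lambda>y. g (x, y)) z) \<le> \<delta> \<and> real K \<le> N"
    by (rule solvesD[OF solve(1)])
      (use w(2) gz section_PL[OF zero_le_sbar] section_lipschitz_gradient[OF zero_le_sbar] in simp_all)
  then obtain z K where z: "solve_z (\<lambda>y. g (x, y)) (z_pt st) = Some (z, K)"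
    "norm (snd (penalized_grad 0 (x, z))) \<le> \<delta>" "real K \<le> N"
    unfolding gz by blast
  define h where "h = (\<lambda>y. s * f (x, y) + g (x, y))"
  have h: "h = (\<lambda>y. penalized s (x, y))" by (simp add: h_def penalized_def)
  have gy: "grad h v = snd (penalized_grad s (x, v))" for v
    unfolding h by (rule section_grad)
  have "\<exists>y M. solve_y h (y_pt st) = Some (y, M) \<and> norm (grad h y) \<le> \<delta> \<and> real M \<le> N"
    by (rule solvesD[OF solve(2)])
      (use w(3) gy section_PL[OF s' s(2), of x] section_lipschitz_gradient[OF s' s(2), of x]
       in \<open>simp_all add: h[symmetric]\<close>)
  then obtain y M where y: "solve_y (\<lambda>y. s * f (x, y) + g (x, y)) (y_pt st) = Some (y, M)"
    "norm (snd (penalized_grad s (x, y))) \<le> \<delta>" "real M \<le> N"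
    unfolding gy unfolding h_def by blast
  define d where "d = grad (\<lambda>u. f (u, y)) x +
              (1 / s) *\<^sub>R (grad (\<lambda>u. g (u, y)) x - grad (\<lambda>u. g (u, z)) x)"
  define a' where "a' = sqrt ((a_par st)\<^sup>2 + (norm d)\<^sup>2)"
  define x' where "x' = x - (1 / a') *\<^sub>R d"
  define st' where "st' = \<lparr>x_pt = x', y_pt = y, z_pt = z, a_par = a',
               calls = calls st + (K + 1) + 2 * (M + 1) + 3\<rparr>"
  have step: "bilevel_step solve_z solve_y f g s st = Some st'"
    using z(1) y(1)
    by (simp add: bilevel_step_def x_def[symmetric] d_def a'_def st'_def x'_def Let_def)
  have a': "a' > 0" unfolding a'_def using w(1) by (simp add: add_pos_nonneg)
  \<comment> \<open>The normalisation limits the move of \<open>x\<close> to length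
    \<open>1\<close>. A \<open>y\<close>-gradient of at most \<open>\<delta> \<le> 1\<close> then
    grows by at most \<open>L\<close>, whence \<open>1 + L \<le> D\<close>.\<close>
  have "norm d \<le> a'" unfolding a'_def by (rule real_le_rsqrt) simp
  then have moved: "norm (x' - x) \<le> 1" using a' by (simp add: x'_def)
  have drift: "norm (snd (penalized_grad r (x', v))) \<le> D"
    if r: "0 \<le> r" "r \<le> \<sigma>bar" and v: "norm (snd (penalized_grad r (x, v))) \<le> \<delta>" for r v
  proof -
    have "norm (snd (penalized_grad r (x', v) - penalized_grad r (x, v))) \<le> L * norm (x' - x)"
      using norm_snd_le_norm[of "penalized_grad r (x', v) - penalized_grad r (x, v)"]
        penalized_grad_lipschitz[OF r, of "(x', v)" "(x, v)"] by (simp add: norm_Pair)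
    also have "\<dots> \<le> L" using moved constants_pos by (simp add: mult_left_le)
    finally have "norm (snd (penalized_grad r (x', v))) \<le> norm (snd (penalized_grad r (x, v))) + L"
      using norm_triangle_sub[of "snd (penalized_grad r (x', v))" "snd (penalized_grad r (x, v))"]
      by (simp add: snd_diff)
    then show ?thesis using v \<open>\<delta> \<le> 1\<close> \<open>1 + L \<le> D\<close> by linarith
  qed
  have "warm s D st'"
    unfolding warm_def st'_def using a' drift[OF zero_le_sbar z(2)] drift[OF s' s(2) y(2)] by simp
  moreover have "norm (d - grad \<phi> (x_pt st)) \<le> 2 * L * \<kappa> * \<delta> / s + doubling_bound * s"
    using hypergradient_error[OF s y(2) z(2)] unfolding d_def x_def .
  moreover have "real (calls st') \<le> real (calls st) + (3 * N + 6)"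
    using z(3) y(3) by (simp add: st'_def)
  ultimately show ?thesis using that[OF step] by (simp add: st'_def a'_def x'_def x_def)
qed

text \<open>Here \<open>c * \<epsilon>\<close> is the hypergradient error for
  \<open>s = \<epsilon>\<close> and \<open>\<delta> = \<epsilon>\<^sup>2\<close>. The term
  \<open>c\<^sup>2 / a\<^sub>0\<close> collects the squared errors of up to
  \<open>2 / \<epsilon>\<^sup>2\<close> steps, \<open>mixed_bound + 1\<close> is a positive
  smoothness constant, and the final \<open>c\<close> passes from the computed direction to the true
  gradient.\<close>

definition rate_bound :: "real \<Rightarrow> 'a \<Rightarrow> real \<Rightarrow> real" where
  "rate_bound m x\<^sub>0 a\<^sub>0 =
     (let c = 2 * L * \<kappa> + doubling_bound
      in a\<^sub>0 + 4 * (\<phi> x\<^sub>0 - m + c\<^sup>2 / a\<^sub>0 + 16 * (mixed_bound + 1) ^ 3 / a\<^sub>0\<^sup>2) + c)"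

lemma bilevel_run_correct:
  fixes x\<^sub>0 :: 'a
  assumes \<epsilon>: "0 < \<epsilon>" "\<epsilon> \<le> \<sigma>bar" "\<epsilon> \<le> 1" and "a\<^sub>0 > 0" and m: "\<And>x. m \<le> \<phi> x"
    and D: "1 + L \<le> D" "norm (snd (grad g (x\<^sub>0, z\<^sub>0))) \<le> D"
      "norm (snd (grad g (x\<^sub>0, y\<^sub>0))) + \<sigma>bar * l \<le> D"
    and solve: "solves solve_z D (\<epsilon>\<^sup>2) N" "solves solve_y D (\<epsilon>\<^sup>2) N"
    and run: "run \<epsilon> = bilevel solve_z solve_y f g \<epsilon> x\<^sub>0 y\<^sub>0 z\<^sub>0 a\<^sub>0"
  shows "run \<epsilon> (outer_iters \<epsilon>) \<noteq> None"
    and "best_grad_norm \<phi> run \<epsilon> \<le> rate_bound m x\<^sub>0 a\<^sub>0 * \<epsilon>"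
    and "real (oracle_calls run \<epsilon>) \<le> real (outer_iters \<epsilon>) * (3 * N + 6)"
proof -
  define st where "st t = the (run \<epsilon> t)" for t
  \<comment> \<open>\<open>D\<close> must serve all \<open>\<epsilon>\<close> at once, hence the
    summand \<open>\<sigma>bar * l\<close> in its lower bound.\<close>
  have "norm (snd (penalized_grad \<epsilon> (x\<^sub>0, y\<^sub>0))) \<le> D"
  proof -
    have "norm (\<epsilon> *\<^sub>R snd (grad f (x\<^sub>0, y\<^sub>0))) \<le> \<sigma>bar * l"
      using \<epsilon> l_pos norm_snd_le_norm[of "grad f (x\<^sub>0, y\<^sub>0)"]
        norm_gradient_le_lipschitz[OF lipschitz_gradientD(1)[OF lg_f] lip_f, of "(x\<^sub>0, y\<^sub>0)"]
      by (auto intro!: mult_mono)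
    then show ?thesis
      using norm_triangle_ineq[of "\<epsilon> *\<^sub>R snd (grad f (x\<^sub>0, y\<^sub>0))" "snd (grad g (x\<^sub>0, y\<^sub>0))"] D(3)
      by (simp add: penalized_grad_def)
  qed
  then have warm0: "warm \<epsilon> D \<lparr>x_pt = x\<^sub>0, y_pt = y\<^sub>0, z_pt = z\<^sub>0, a_par = a\<^sub>0, calls = 0\<rparr>"
    using D \<open>a\<^sub>0 > 0\<close> by (simp add: warm_def)
  have sq: "\<epsilon>\<^sup>2 \<le> 1" using \<epsilon> by (simp add: power_le_one)
  note step = bilevel_step_correct[OF \<epsilon>(1,2) solve sq D(1)]
  have inv: "run \<epsilon> t = Some (st t) \<and> warm \<epsilon> D (st t) \<and> real (calls (st t)) \<le> real t * (3 * N + 6)" for t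
  proof (induction t)
    case 0
    then show ?case using warm0 by (simp add: run st_def)
  next
    case (Suc t)
    then have IH: "run \<epsilon> t = Some (st t)" "warm \<epsilon> D (st t)" "real (calls (st t)) \<le> real t * (3 * N + 6)"
      by auto
    obtain st' d where st': "bilevel_step solve_z solve_y f g \<epsilon> (st t) = Some st'" "warm \<epsilon> D st'"
      "real (calls st') \<le> real (calls (st t)) + (3 * N + 6)"
      using step[OF IH(2)] by metis
    have eq: "run \<epsilon> (Suc t) = Some st'" using IH(1) st'(1) by (simp add: run)
    then have "st (Suc t) = st'" by (simp add: st_def)
    then show ?case using eq st' IH(3) by (simp add: distrib_right)
  qed
  show "run \<epsilon> (outer_iters \<epsilon>) \<noteq> None" using inv by simp
  show "real (oracle_calls run \<epsilon>) \<le> real (outer_iters \<epsilon>) * (3 * N + 6)"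
    unfolding oracle_calls_def using inv[of "outer_iters \<epsilon>"] by (simp add: st_def)
  define c where "c = 2 * L * \<kappa> + doubling_bound"
  have "\<exists>d. a_par (st (Suc t)) = sqrt ((a_par (st t))\<^sup>2 + (norm d)\<^sup>2) \<and>
    x_pt (st (Suc t)) = x_pt (st t) - (1 / a_par (st (Suc t))) *\<^sub>R d \<and>
    norm (d - grad \<phi> (x_pt (st t))) \<le> c * \<epsilon>" for t
  proof -
    have IH: "run \<epsilon> t = Some (st t)" "warm \<epsilon> D (st t)" using inv[of t] by auto
    obtain st' d where st': "bilevel_step solve_z solve_y f g \<epsilon> (st t) = Some st'"
      "a_par st' = sqrt ((a_par (st t))\<^sup>2 + (norm d)\<^sup>2)" "x_pt st' = x_pt (st t) - (1 / a_par st') *\<^sub>R d"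
      "norm (d - grad \<phi> (x_pt (st t))) \<le> 2 * L * \<kappa> * \<epsilon>\<^sup>2 / \<epsilon> + doubling_bound * \<epsilon>"
      using step[OF IH(2)] by metis
    have "run \<epsilon> (Suc t) = Some st'" using IH(1) st'(1) by (simp add: run)
    then have eq: "st (Suc t) = st'" by (simp add: st_def)
    have "2 * L * \<kappa> * \<epsilon>\<^sup>2 / \<epsilon> + doubling_bound * \<epsilon> = c * \<epsilon>"
      using \<epsilon>(1) by (simp add: c_def power2_eq_square distrib_right)
    then show ?thesis using st'(2-4) unfolding eq by metis
  qed
  then obtain d where d: "\<And>t. a_par (st (Suc t)) = sqrt ((a_par (st t))\<^sup>2 + (norm (d t))\<^sup>2)"
    "\<And>t. x_pt (st (Suc t)) = x_pt (st t) - (1 / a_par (st (Suc t))) *\<^sub>R d t"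
    "\<And>t. norm (d t - grad \<phi> (x_pt (st t))) \<le> c * \<epsilon>" by metis
  define T where "T = outer_iters \<epsilon>"
  note T = outer_iters_bounds[OF \<epsilon>(1,3), folded T_def]
  define A where "A = a\<^sub>0 + 4 * (\<phi> x\<^sub>0 - m + c\<^sup>2 / a\<^sub>0 + 16 * (mixed_bound + 1) ^ 3 / a\<^sub>0\<^sup>2)"
  have st0: "x_pt (st 0) = x\<^sub>0" "a_par (st 0) = a\<^sub>0" by (auto simp: st_def run)
  have "(\<Sum>t<T. (norm (d t))\<^sup>2) \<le> (a_par (st 0) + 4 * (\<phi> (x_pt (st 0)) - m
      + T * (c * \<epsilon>)\<^sup>2 / (2 * a_par (st 0)) + 16 * (mixed_bound + 1) ^ 3 / (a_par (st 0))\<^sup>2))\<^sup>2"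
  proof (rule adagrad_norm_bound[where D = "grad \<phi>" and x = "\<lambda>t. x_pt (st t)" and a = "\<lambda>t. a_par (st t)"])
    show "\<phi> z - \<phi> y - grad \<phi> y \<bullet> (z - y) \<le> (mixed_bound + 1) * (norm (z - y))\<^sup>2" for y z
      using hyper_objective_smooth(2)[OF \<epsilon>(1,2), of z y] zero_le_power2[of "norm (z - y)"]
      unfolding distrib_right by linarith
    show "(norm (d k - grad \<phi> (x_pt (st k))))\<^sup>2 \<le> (c * \<epsilon>)\<^sup>2" for k
      using d(3) by (intro power_mono) auto
    show "0 < mixed_bound + 1" using mixed_bound_nonneg by linarith
  qed (use m d(1,2) st0 \<open>a\<^sub>0 > 0\<close> in auto)
  also have "\<dots> \<le> A\<^sup>2"
  proof (rule power_mono)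
    have "real T * (c * \<epsilon>)\<^sup>2 \<le> (2 / \<epsilon>\<^sup>2) * (c * \<epsilon>)\<^sup>2" using T(2) by (intro mult_right_mono) auto
    also have "\<dots> = 2 * c\<^sup>2" using \<epsilon>(1) by (simp add: power_mult_distrib)
    finally have "real T * (c * \<epsilon>)\<^sup>2 / (2 * a\<^sub>0) \<le> 2 * c\<^sup>2 / (2 * a\<^sub>0)"
      using \<open>a\<^sub>0 > 0\<close> by (intro divide_right_mono) auto
    also have "\<dots> = c\<^sup>2 / a\<^sub>0" by simp
    finally have "real T * (c * \<epsilon>)\<^sup>2 / (2 * a\<^sub>0) \<le> c\<^sup>2 / a\<^sub>0" .
    then show "a_par (st 0) + 4 * (\<phi> (x_pt (st 0)) - m + T * (c * \<epsilon>)\<^sup>2 / (2 * a_par (st 0))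
        + 16 * (mixed_bound + 1) ^ 3 / (a_par (st 0))\<^sup>2) \<le> A"
      unfolding A_def st0 by (intro add_left_mono add_right_mono mult_left_mono) auto
    show "0 \<le> a_par (st 0) + 4 * (\<phi> (x_pt (st 0)) - m + T * (c * \<epsilon>)\<^sup>2 / (2 * a_par (st 0))
        + 16 * (mixed_bound + 1) ^ 3 / (a_par (st 0))\<^sup>2)"
      unfolding st0 using m[of x\<^sub>0] \<open>a\<^sub>0 > 0\<close> mixed_bound_nonneg by simp
  qed
  finally have sum: "(\<Sum>t<T. (norm (d t))\<^sup>2) \<le> A\<^sup>2" .
  have A: "A \<ge> 0" unfolding A_def using m[of x\<^sub>0] \<open>a\<^sub>0 > 0\<close> mixed_bound_nonneg by simp
  \<comment> \<open>Pigeonhole: at least \<open>1 / \<epsilon>\<^sup>2\<close> steps share a sum of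
    squares of at most \<open>A\<^sup>2\<close>.\<close>
  obtain t where t: "t < T" "norm (d t) \<le> A * \<epsilon>"
  proof (rule ccontr)
    assume "\<not> thesis"
    then have "\<forall>t<T. A * \<epsilon> < norm (d t)" using that by (meson not_less)
    then have "(\<Sum>t<T. (A * \<epsilon>)\<^sup>2) < (\<Sum>t<T. (norm (d t))\<^sup>2)"
      using T(3) A \<epsilon>(1) by (intro sum_strict_mono power_strict_mono) auto
    moreover have "A\<^sup>2 \<le> (\<Sum>t<T. (A * \<epsilon>)\<^sup>2)"
    proof -
      have "A\<^sup>2 = 1 / \<epsilon>\<^sup>2 * (A * \<epsilon>)\<^sup>2" using \<epsilon>(1) by (simp add: power_mult_distrib)
      also have "\<dots> \<le> real T * (A * \<epsilon>)\<^sup>2" using T(1) by (intro mult_right_mono) auto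
      finally show ?thesis by simp
    qed
    ultimately show False using sum by linarith
  qed
  have "best_grad_norm \<phi> run \<epsilon> \<le> norm (grad \<phi> (x_pt (st t)))"
    unfolding best_grad_norm_def st_def T_def[symmetric] using t(1) by (intro Min_le) auto
  also have "\<dots> \<le> norm (d t) + norm (d t - grad \<phi> (x_pt (st t)))"
    using norm_triangle_sub[of "grad \<phi> (x_pt (st t))" "d t"] by (simp add: norm_minus_commute)
  also have "\<dots> \<le> A * \<epsilon> + c * \<epsilon>" using t(2) d(3) by (intro add_mono)
  also have "\<dots> = rate_bound m x\<^sub>0 a\<^sub>0 * \<epsilon>"
    by (simp add: rate_bound_def Let_def A_def c_def distrib_right)
  finally show "best_grad_norm \<phi> run \<epsilon> \<le> rate_bound m x\<^sub>0 a\<^sub>0 * \<epsilon>" .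
qed

lemma AdaG_N_solves:
  assumes "b > 0"
  shows "\<exists>c\<ge>0. \<forall>\<epsilon>>0. solves (\<lambda>h v. AdaG_N h v b (\<epsilon>\<^sup>2)) D (\<epsilon>\<^sup>2) (c / \<epsilon> ^ 4)"
proof (intro exI[of _ "(b + 4 * (D\<^sup>2 / (2 * \<mu>) + 16 * L ^ 3 / b\<^sup>2))\<^sup>2"] conjI allI impI)
  fix \<epsilon> :: real
  assume "\<epsilon> > 0"
  moreover have "\<epsilon> ^ 4 = (\<epsilon>\<^sup>2)\<^sup>2" by (simp flip: power_mult)
  ultimately show "solves (\<lambda>h v. AdaG_N h v b (\<epsilon>\<^sup>2)) D (\<epsilon>\<^sup>2)
      ((b + 4 * (D\<^sup>2 / (2 * \<mu>) + 16 * L ^ 3 / b\<^sup>2))\<^sup>2 / \<epsilon> ^ 4)"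
    unfolding solves_def
    using AdaG_N_correct[OF _ _ mu_pos constants_pos(1) assms, of _ "\<epsilon>\<^sup>2"] zero_less_power[of \<epsilon> 2]
    by (metis (no_types, lifting))
qed simp

lemma AC_GM_solves:
  assumes "\<alpha> > 1" "L\<^sub>0 > 0"
  shows "\<exists>c\<ge>0. \<forall>\<epsilon>>0. solves (\<lambda>h v. AC_GM h v \<alpha> L\<^sub>0 (\<epsilon>\<^sup>2)) D (\<epsilon>\<^sup>2) (c * (1 + \<bar>ln (\<epsilon>\<^sup>2)\<bar>))"
proof -
  obtain c where c: "c \<ge> 0" "\<forall>(h :: 'b \<Rightarrow> real) v\<^sub>0 \<epsilon>.
    PL \<mu> h \<longrightarrow> lipschitz_gradient L h \<longrightarrow> norm (grad h v\<^sub>0) \<le> D \<longrightarrow> \<epsilon> > 0 \<longrightarrow>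
    (\<exists>v k. AC_GM h v\<^sub>0 \<alpha> L\<^sub>0 \<epsilon> = Some (v, k) \<and> norm (grad h v) \<le> \<epsilon> \<and>
       real k \<le> c * (1 + \<bar>ln \<epsilon>\<bar>))"
    using AC_GM_correct[OF mu_pos constants_pos(1) assms, of D] by blast
  show ?thesis
    unfolding solves_def using c(1) c(2)[rule_format] zero_less_power by (intro exI[of _ c]) blast
qed

end

section \<open>Convergence rate and oracle complexity\<close>

theorem theorem3p1:
  fixes f g :: "'a::euclidean_space \<times> 'b::euclidean_space \<Rightarrow> real"
    and \<mu> \<sigma>bar l_f L_f L_g \<rho>_f \<rho>_g :: real
    and x\<^sub>0 :: 'a and y\<^sub>0 z\<^sub>0 :: 'b
    and a\<^sub>0 b\<^sub>0 c\<^sub>0 \<alpha> L\<^sub>1 L\<^sub>2 :: real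
  defines "\<phi> \<equiv> hyper_objective f g"
    and "run_AF \<equiv> AF2BA f g x\<^sub>0 y\<^sub>0 z\<^sub>0 a\<^sub>0 b\<^sub>0 c\<^sub>0"
    and "run_A2F \<equiv> A2F2BA f g x\<^sub>0 y\<^sub>0 z\<^sub>0 a\<^sub>0 \<alpha> L\<^sub>1 L\<^sub>2"
  assumes "\<mu> > 0" "\<sigma>bar > 0" "l_f > 0" "L_f > 0" "L_g > 0" "\<rho>_f > 0" "\<rho>_g > 0"
    and "\<And>\<sigma> x. 0 \<le> \<sigma> \<Longrightarrow> \<sigma> \<le> \<sigma>bar \<Longrightarrow> PL \<mu> (\<lambda>y. \<sigma> * f (x, y) + g (x, y))"
    and "l_f-lipschitz_on UNIV f" "lipschitz_gradient L_f f"
    and "lipschitz_gradient L_g g"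
    and "lipschitz_hessian \<rho>_f f"
    and "lipschitz_hessian \<rho>_g g"
    and "\<And>x. \<exists>y\<in>lower_argmin g x. \<forall>y'\<in>lower_argmin g x. f (x, y) \<le> f (x, y')"
    and "bdd_below (range \<phi>)"
    and "a\<^sub>0 > 0" "b\<^sub>0 > 0" "c\<^sub>0 > 0" "\<alpha> > 1" "L\<^sub>1 > 0" "L\<^sub>2 > 0"
  shows
    "(\<forall>\<^sub>F \<epsilon> in at_right 0. run_AF \<epsilon> (outer_iters \<epsilon>) \<noteq> None) \<and>
     best_grad_norm \<phi> run_AF \<in> O[at_right 0](\<lambda>\<epsilon>. \<epsilon>) \<and>
     (\<lambda>\<epsilon>. real (oracle_calls run_AF \<epsilon>)) \<in> O[at_right 0](\<lambda>\<epsilon>. 1 / \<epsilon> ^ 6) \<and>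
     (\<forall>\<^sub>F \<epsilon> in at_right 0. run_A2F \<epsilon> (outer_iters \<epsilon>) \<noteq> None) \<and>
     best_grad_norm \<phi> run_A2F \<in> O[at_right 0](\<lambda>\<epsilon>. \<epsilon>) \<and>
     (\<exists>p::nat. (\<lambda>\<epsilon>. real (oracle_calls run_A2F \<epsilon>))
        \<in> O[at_right 0](\<lambda>\<epsilon>. 1 / \<epsilon>\<^sup>2 * ln (1 / \<epsilon>) ^ p))"
proof -
  interpret bilevel_problem f g \<mu> \<sigma>bar l_f L_f L_g \<rho>_g
    by unfold_locales (fact assms)+
  obtain m where m: "m \<le> hyper_objective f g x" for x
    using \<open>bdd_below (range \<phi>)\<close> unfolding \<phi>_def bdd_below_def by blast
  define D where "D = 1 + L + norm (snd (grad g (x\<^sub>0, z\<^sub>0))) + norm (snd (grad g (x\<^sub>0, y\<^sub>0))) + \<sigma>bar * l_f"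
  have D: "1 + L \<le> D" "norm (snd (grad g (x\<^sub>0, z\<^sub>0))) \<le> D"
      "norm (snd (grad g (x\<^sub>0, y\<^sub>0))) + \<sigma>bar * l_f \<le> D"
    using constants_pos sbar_pos l_pos unfolding D_def by (simp_all add: add_nonneg_nonneg)
  \<comment> \<open>Below \<open>exp (- 1)\<close> the factor \<open>ln (1 / \<epsilon>)\<close> is
    at least \<open>1\<close> and can absorb constants.\<close>
  define e where "e = min \<sigma>bar (exp (- 1))"
  have "\<forall>\<^sub>F \<epsilon> in at_right 0. 0 < \<epsilon> \<and> \<epsilon> < e"
    unfolding eventually_at_right_field using sbar_pos by (intro exI[of _ e]) (auto simp: e_def)
  then have small: "\<forall>\<^sub>F \<epsilon> in at_right 0. 0 < \<epsilon> \<and> \<epsilon> \<le> \<sigma>bar \<and> \<epsilon> \<le> 1 \<and> 1 \<le> ln (1 / \<epsilon>)"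
  proof (rule eventually_mono)
    fix \<epsilon> :: real
    assume *: "0 < \<epsilon> \<and> \<epsilon> < e"
    then have "ln \<epsilon> < ln (exp (- 1))" by (subst ln_less_cancel_iff) (auto simp: e_def)
    then have "ln \<epsilon> < - 1" by simp
    moreover have "\<epsilon> \<le> exp (- 1)" using * by (simp add: e_def)
    then have "\<epsilon> \<le> 1" by (rule order_trans) simp
    ultimately show "0 < \<epsilon> \<and> \<epsilon> \<le> \<sigma>bar \<and> \<epsilon> \<le> 1 \<and> 1 \<le> ln (1 / \<epsilon>)"
      using * by (simp add: e_def ln_div)
  qed
  let ?C = "rate_bound m x\<^sub>0 a\<^sub>0"
  have AF: "\<exists>c\<ge>0. \<forall>\<epsilon>. 0 < \<epsilon> \<and> \<epsilon> \<le> \<sigma>bar \<and> \<epsilon> \<le> 1 \<longrightarrow> run_AF \<epsilon> (outer_iters \<epsilon>) \<noteq> None \<and>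
      best_grad_norm \<phi> run_AF \<epsilon> \<le> ?C * \<epsilon> \<and>
      real (oracle_calls run_AF \<epsilon>) \<le> real (outer_iters \<epsilon>) * (3 * (c / \<epsilon> ^ 4) + 6)"
  proof -
    obtain c1 where c1: "c1 \<ge> 0"
      "\<forall>\<epsilon>>0. solves (\<lambda>h v. AdaG_N h v b\<^sub>0 (\<epsilon>\<^sup>2)) D (\<epsilon>\<^sup>2) (c1 / \<epsilon> ^ 4)"
      using AdaG_N_solves[OF \<open>b\<^sub>0 > 0\<close>, of D] by blast
    obtain c2 where c2: "c2 \<ge> 0"
      "\<forall>\<epsilon>>0. solves (\<lambda>h v. AdaG_N h v c\<^sub>0 (\<epsilon>\<^sup>2)) D (\<epsilon>\<^sup>2) (c2 / \<epsilon> ^ 4)"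
      using AdaG_N_solves[OF \<open>c\<^sub>0 > 0\<close>, of D] by blast
    show ?thesis
    \<comment> \<open>The two inner solvers have different initial parameters; the sum bounds both
      of their runs.\<close>
    proof (intro exI[of _ "c1 + c2"] conjI allI impI; (elim conjE)?)
      fix \<epsilon> :: real
      assume \<epsilon>: "0 < \<epsilon>" "\<epsilon> \<le> \<sigma>bar" "\<epsilon> \<le> 1"
      have "solves (\<lambda>h v. AdaG_N h v b\<^sub>0 (\<epsilon>\<^sup>2)) D (\<epsilon>\<^sup>2) ((c1 + c2) / \<epsilon> ^ 4)"
        "solves (\<lambda>h v. AdaG_N h v c\<^sub>0 (\<epsilon>\<^sup>2)) D (\<epsilon>\<^sup>2) ((c1 + c2) / \<epsilon> ^ 4)"
        using solves_mono[OF c1(2)[rule_format, OF \<epsilon>(1)]] solves_mono[OF c2(2)[rule_format, OF \<epsilon>(1)]]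
          c1(1) c2(1) by (auto simp: divide_right_mono)
      note run = bilevel_run_correct[OF \<epsilon> \<open>a\<^sub>0 > 0\<close> m D this, of run_AF]
      show "run_AF \<epsilon> (outer_iters \<epsilon>) \<noteq> None" "best_grad_norm \<phi> run_AF \<epsilon> \<le> ?C * \<epsilon>"
        "real (oracle_calls run_AF \<epsilon>) \<le> real (outer_iters \<epsilon>) * (3 * ((c1 + c2) / \<epsilon> ^ 4) + 6)"
        using run unfolding run_AF_def \<phi>_def AF2BA_def by blast+
    qed (use c1 c2 in simp)
  qed
  have A2F: "\<exists>c\<ge>0. \<forall>\<epsilon>. 0 < \<epsilon> \<and> \<epsilon> \<le> \<sigma>bar \<and> \<epsilon> \<le> 1 \<longrightarrow> run_A2F \<epsilon> (outer_iters \<epsilon>) \<noteq> None \<and>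
      best_grad_norm \<phi> run_A2F \<epsilon> \<le> ?C * \<epsilon> \<and>
      real (oracle_calls run_A2F \<epsilon>)
        \<le> real (outer_iters \<epsilon>) * (3 * (c * (1 + \<bar>ln (\<epsilon>\<^sup>2)\<bar>)) + 6)"
  proof -
    obtain c1 where c1: "c1 \<ge> 0"
      "\<forall>\<epsilon>>0. solves (\<lambda>h v. AC_GM h v \<alpha> L\<^sub>1 (\<epsilon>\<^sup>2)) D (\<epsilon>\<^sup>2) (c1 * (1 + \<bar>ln (\<epsilon>\<^sup>2)\<bar>))"
      using AC_GM_solves[OF \<open>\<alpha> > 1\<close> \<open>L\<^sub>1 > 0\<close>, of D] by blast
    obtain c2 where c2: "c2 \<ge> 0"
      "\<forall>\<epsilon>>0. solves (\<lambda>h v. AC_GM h v \<alpha> L\<^sub>2 (\<epsilon>\<^sup>2)) D (\<epsilon>\<^sup>2) (c2 * (1 + \<bar>ln (\<epsilon>\<^sup>2)\<bar>))"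
      using AC_GM_solves[OF \<open>\<alpha> > 1\<close> \<open>L\<^sub>2 > 0\<close>, of D] by blast
    show ?thesis
    proof (intro exI[of _ "c1 + c2"] conjI allI impI; (elim conjE)?)
      fix \<epsilon> :: real
      assume \<epsilon>: "0 < \<epsilon>" "\<epsilon> \<le> \<sigma>bar" "\<epsilon> \<le> 1"
      have "solves (\<lambda>h v. AC_GM h v \<alpha> L\<^sub>1 (\<epsilon>\<^sup>2)) D (\<epsilon>\<^sup>2) ((c1 + c2) * (1 + \<bar>ln (\<epsilon>\<^sup>2)\<bar>))"
        "solves (\<lambda>h v. AC_GM h v \<alpha> L\<^sub>2 (\<epsilon>\<^sup>2)) D (\<epsilon>\<^sup>2) ((c1 + c2) * (1 + \<bar>ln (\<epsilon>\<^sup>2)\<bar>))"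
        using solves_mono[OF c1(2)[rule_format, OF \<epsilon>(1)]] solves_mono[OF c2(2)[rule_format, OF \<epsilon>(1)]]
          c1(1) c2(1) by (auto simp: mult_right_mono)
      note run = bilevel_run_correct[OF \<epsilon> \<open>a\<^sub>0 > 0\<close> m D this, of run_A2F]
      show "run_A2F \<epsilon> (outer_iters \<epsilon>) \<noteq> None" "best_grad_norm \<phi> run_A2F \<epsilon> \<le> ?C * \<epsilon>"
        "real (oracle_calls run_A2F \<epsilon>)
          \<le> real (outer_iters \<epsilon>) * (3 * ((c1 + c2) * (1 + \<bar>ln (\<epsilon>\<^sup>2)\<bar>)) + 6)"
        using run unfolding run_A2F_def \<phi>_def A2F2BA_def by blast+
    qed (use c1 c2 in simp)
  qed
  have rate: "best_grad_norm \<phi> run \<in> O[at_right 0](\<lambda>\<epsilon>. \<epsilon>)"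
    if "\<And>\<epsilon>. 0 < \<epsilon> \<Longrightarrow> \<epsilon> \<le> \<sigma>bar \<Longrightarrow> \<epsilon> \<le> 1 \<Longrightarrow> best_grad_norm \<phi> run \<epsilon> \<le> ?C * \<epsilon>"
    for run :: "real \<Rightarrow> nat \<Rightarrow> ('a, 'b) bilevel_state option"
  proof (rule bigoI[of _ ?C], use small in \<open>rule eventually_mono\<close>)
    fix \<epsilon> :: real
    assume "0 < \<epsilon> \<and> \<epsilon> \<le> \<sigma>bar \<and> \<epsilon> \<le> 1 \<and> 1 \<le> ln (1 / \<epsilon>)"
    then show "norm (best_grad_norm \<phi> run \<epsilon>) \<le> ?C * norm \<epsilon>"
      using that[of \<epsilon>] best_grad_norm_nonneg[OF outer_iters_bounds(3), of \<epsilon> \<phi> run] by simp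
  qed
  obtain c where c: "c \<ge> 0" "\<And>\<epsilon>. 0 < \<epsilon> \<Longrightarrow> \<epsilon> \<le> \<sigma>bar \<Longrightarrow> \<epsilon> \<le> 1 \<Longrightarrow>
      run_AF \<epsilon> (outer_iters \<epsilon>) \<noteq> None \<and> best_grad_norm \<phi> run_AF \<epsilon> \<le> ?C * \<epsilon> \<and>
      real (oracle_calls run_AF \<epsilon>) \<le> real (outer_iters \<epsilon>) * (3 * (c / \<epsilon> ^ 4) + 6)"
    using AF by blast
  obtain c' where c': "c' \<ge> 0" "\<And>\<epsilon>. 0 < \<epsilon> \<Longrightarrow> \<epsilon> \<le> \<sigma>bar \<Longrightarrow> \<epsilon> \<le> 1 \<Longrightarrow>
      run_A2F \<epsilon> (outer_iters \<epsilon>) \<noteq> None \<and> best_grad_norm \<phi> run_A2F \<epsilon> \<le> ?C * \<epsilon> \<and>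
      real (oracle_calls run_A2F \<epsilon>)
        \<le> real (outer_iters \<epsilon>) * (3 * (c' * (1 + \<bar>ln (\<epsilon>\<^sup>2)\<bar>)) + 6)"
    using A2F by blast
  \<comment> \<open>At most \<open>2 / \<epsilon>\<^sup>2\<close> outer steps cost at most
    \<open>(3 * c + 6) / \<epsilon> ^ 4\<close> calls each.\<close>
  have "(\<lambda>\<epsilon>. real (oracle_calls run_AF \<epsilon>)) \<in> O[at_right 0](\<lambda>\<epsilon>. 1 / \<epsilon> ^ 6)"
  proof (rule bigoI[of _ "6 * c + 12"], use small in \<open>rule eventually_mono\<close>)
    fix \<epsilon> :: real
    assume \<epsilon>: "0 < \<epsilon> \<and> \<epsilon> \<le> \<sigma>bar \<and> \<epsilon> \<le> 1 \<and> 1 \<le> ln (1 / \<epsilon>)"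
    have "\<epsilon> ^ 4 \<le> 1" using \<epsilon> by (simp add: power_le_one)
    then have "6 \<le> 6 / \<epsilon> ^ 4" using \<epsilon> by (simp add: le_divide_eq)
    have "real (oracle_calls run_AF \<epsilon>) \<le> real (outer_iters \<epsilon>) * (3 * (c / \<epsilon> ^ 4) + 6)" using c \<epsilon> by blast
    also have "\<dots> \<le> (2 / \<epsilon>\<^sup>2) * (3 * (c / \<epsilon> ^ 4) + 6 / \<epsilon> ^ 4)"
      using outer_iters_bounds(2) \<epsilon> c(1) \<open>6 \<le> 6 / \<epsilon> ^ 4\<close> by (intro mult_mono add_left_mono) auto
    also have "\<dots> = (6 * c + 12) * (1 / (\<epsilon>\<^sup>2 * \<epsilon> ^ 4))" using \<epsilon> by (simp add: field_simps)
    also have "\<epsilon>\<^sup>2 * \<epsilon> ^ 4 = \<epsilon> ^ 6" by (simp flip: power_add)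
    finally show "norm (real (oracle_calls run_AF \<epsilon>)) \<le> (6 * c + 12) * norm (1 / \<epsilon> ^ 6)"
      using \<epsilon> by simp
  qed
  \<comment> \<open>The first power of the logarithm suffices: for \<open>w \<ge> 1\<close> the cost
    \<open>3 * c' * (1 + 2 * w) + 6\<close> of an outer step is at most
    \<open>(9 * c' + 6) * w\<close>.\<close>
  moreover have "(\<lambda>\<epsilon>. real (oracle_calls run_A2F \<epsilon>)) \<in> O[at_right 0](\<lambda>\<epsilon>. 1 / \<epsilon>\<^sup>2 * ln (1 / \<epsilon>) ^ 1)"
  proof (rule bigoI[of _ "18 * c' + 12"], use small in \<open>rule eventually_mono\<close>)
    fix \<epsilon> :: real
    assume \<epsilon>: "0 < \<epsilon> \<and> \<epsilon> \<le> \<sigma>bar \<and> \<epsilon> \<le> 1 \<and> 1 \<le> ln (1 / \<epsilon>)"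
    define w where "w = ln (1 / \<epsilon>)"
    have w: "w \<ge> 1" "\<bar>ln (\<epsilon>\<^sup>2)\<bar> = 2 * w" using \<epsilon> by (auto simp: w_def ln_div ln_realpow)
    have "real (oracle_calls run_A2F \<epsilon>) \<le> real (outer_iters \<epsilon>) * (3 * (c' * (1 + 2 * w)) + 6)"
      using c' \<epsilon> unfolding w(2)[symmetric] by blast
    also have "\<dots> \<le> (2 / \<epsilon>\<^sup>2) * (3 * (c' * (w + 2 * w)) + 6 * w)"
      using outer_iters_bounds(2) \<epsilon> c'(1) w by (intro mult_mono add_mono mult_left_mono) auto
    also have "\<dots> = (18 * c' + 12) * (1 / \<epsilon>\<^sup>2 * w)" by (simp add: algebra_simps add_divide_distrib)
    finally show "norm (real (oracle_calls run_A2F \<epsilon>)) \<le> (18 * c' + 12) * norm (1 / \<epsilon>\<^sup>2 * ln (1 / \<epsilon>) ^ 1)"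
      using w(1) by (simp add: w_def[symmetric])
  qed
  moreover have "\<forall>\<^sub>F \<epsilon> in at_right 0. run_AF \<epsilon> (outer_iters \<epsilon>) \<noteq> None"
    "\<forall>\<^sub>F \<epsilon> in at_right 0. run_A2F \<epsilon> (outer_iters \<epsilon>) \<noteq> None"
    by (rule eventually_mono[OF small], use c c' in blast)+
  moreover have "best_grad_norm \<phi> run_AF \<in> O[at_right 0](\<lambda>\<epsilon>. \<epsilon>)"
    "best_grad_norm \<phi> run_A2F \<in> O[at_right 0](\<lambda>\<epsilon>. \<epsilon>)"
    using c c' by (auto intro!: rate)
  ultimately show ?thesis by blast
qed

end
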